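(* For $\alpha\in(0,1)$ let $$\nu^\alpha(dz)=(1-\alpha)\frac{dz}{|z|^{N+\alpha}}\quad\text{on }\mathbb{R}^N,$$ and let $\kappa^\alpha[x,u]$ denote the fractional mean curvature associated with $\nu^\alpha$. There is a constant $C>0$ such that the following holds: if $u\in C^2(\mathbb{R}^N)$ and $x\in\mathbb{R}^N$ is such that $Du(x)\ne0$, then $$\kappa^\alpha[x,u]\to C\,\mathrm{div}\left(\frac{Du}{|Du|}\right)(x)\quad\text{as }\alpha\to1,\ \alpha<1 .$$
   Context: For a non-negative measure $\nu$ on $\mathbb{R}^N$ (possibly singular at the origin) and a function $u$ with $Du(x)\ne0$, the fractional mean curvature of $\{u=u(x)\}$ at $x$ associated with $\nu$ is $$\kappa[x,u]=\nu\{z\in\mathbb{R}^N:u(x+z)\ge u(x),\ Du(x)\cdot z\le0\}-\nu\{z\in\mathbb{R}^N:u(x+z)<u(x),\ Du(x)\cdot z>0\}.$$ *)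

theory Defs
  imports "HOL-Analysis.Analysis"
begin

definition grad :: "(real ^ 'n \<Rightarrow> real) \<Rightarrow> real ^ 'n \<Rightarrow> real ^ 'n"
  where "grad u x = (THE D. GDERIV u x :> D)"

definition divergence :: "(real ^ 'n \<Rightarrow> real ^ 'n) \<Rightarrow> real ^ 'n \<Rightarrow> real"
  where "divergence F x = trace (jacobian F (at x))"

definition is_C2 :: "(real ^ 'n \<Rightarrow> real) \<Rightarrow> bool"
  where "is_C2 u \<longleftrightarrow>
    (\<exists>(g :: real ^ 'n \<Rightarrow> real ^ 'n) (H :: real ^ 'n \<Rightarrow> (real ^ 'n) \<Rightarrow>\<^sub>L (real ^ 'n)).
      (\<forall>x. GDERIV u x :> g x) \<and>
      (\<forall>x. (g has_derivative blinfun_apply (H x)) (at x)) \<and>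
      continuous_on UNIV H)"

text \<open>
  The curvature is extended-real-valued because the singular measure \<open>\<nu>\<close> may give infinite
  mass to the two sets; the real-valued \<^const>\<open>measure\<close> would turn an infinite mass into 0.
  As \<open>\<infinity> - \<infinity> = \<infinity>\<close> in \<^typ>\<open>ereal\<close>, a finite value means that both masses are finite.
\<close>

definition frac_mean_curvature ::
    "(real ^ 'n) measure \<Rightarrow> real ^ 'n \<Rightarrow> (real ^ 'n \<Rightarrow> real) \<Rightarrow> ereal"
  where "frac_mean_curvature \<nu> x u =
    enn2ereal (emeasure \<nu> {z. u (x + z) \<ge> u x \<and> grad u x \<bullet> z \<le> 0}) -
    enn2ereal (emeasure \<nu> {z. u (x + z) < u x \<and> grad u x \<bullet> z > 0})"

definition nu_alpha :: "real \<Rightarrow> (real ^ 'n) measure"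
  where "nu_alpha \<alpha> =
    density lborel (\<lambda>z. ennreal ((1 - \<alpha>) / norm z powr (real CARD('n) + \<alpha>)))"

end

theory Submission
  imports Defs
begin

text \<open>
  Writing \<open>|z|\<^bsup>-N-\<alpha>\<^esup>\<close> as \<open>(N + \<alpha>) \<integral> s\<^bsup>-N-\<alpha>-1\<^esup> ds\<close> over \<open>s \<ge> |z|\<close>, the mass of a set \<open>E\<close> becomes
  \<open>(1 - \<alpha>) (N + \<alpha>) \<integral> s\<^bsup>-\<alpha>\<^esup> \<phi>(s) ds\<close> with \<open>\<phi>(s) = |E \<inter> B(0,s)| / s\<^bsup>N+1\<^esup>\<close>. As \<open>\<alpha> \<rightarrow> 1\<close> it tends to
  \<open>(N + 1) \<phi>(0+)\<close>, so only the volume asymptotics at the origin matter. With \<open>e = Du/|Du|\<close>, the two sets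
  in the curvature are trapped between the hyperplane orthogonal to \<open>e\<close> and the graph of
  \<open>-q(y) = - (y \<bullet> D\<^sup>2u y) / (2 |Du|)\<close>, and their limits are the integrals of \<open>q\<^sup>+\<close> and \<open>q\<^sup>-\<close> over the unit disc
  of the hyperplane. The difference is the integral of \<open>q\<close>, which by rotational symmetry is a constant
  times the trace of \<open>D\<^sup>2u/|Du|\<close> on the hyperplane, that is, times \<open>div (Du/|Du|)\<close>.
\<close>

section \<open>Lebesgue measure\<close>

lemma nn_integral_lborel_translate:
  fixes c :: "'a::euclidean_space"
  assumes [measurable]: "f \<in> borel_measurable borel"
  shows "(\<integral>\<^sup>+x. f (c + x) \<partial>lborel) = (\<integral>\<^sup>+x. f x \<partial>lborel)"
  by (subst (2) lborel_distr_plus[of c, symmetric]) (simp add: nn_integral_distr)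

lemma nn_integral_lborel_scale:
  fixes c :: real and f :: "'a::euclidean_space \<Rightarrow> ennreal"
  assumes [measurable]: "f \<in> borel_measurable borel" and "c > 0"
  shows "(\<integral>\<^sup>+x. f x \<partial>lborel) = ennreal (c ^ DIM('a)) * (\<integral>\<^sup>+x. f (c *\<^sub>R x) \<partial>lborel)"
  using assms(2)
  by (subst lborel_affine[of c 0]) (simp_all add: nn_integral_density nn_integral_distr nn_integral_cmult)

text \<open>
  The change of variables for linear maps in the library needs a well-ordered index type, so invariance is
  obtained from the uniqueness argument for Haar measure, with the unit ball as test set.
\<close>

lemma distr_lborel_orthogonal:
  fixes f :: "'a::euclidean_space \<Rightarrow> 'a"
  assumes f: "orthogonal_transformation f"
  shows "distr lborel borel f = lborel"
proof (rule measure_eqI)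
  have lin: "linear f" using f by (simp add: orthogonal_transformation_linear)
  have [measurable]: "f \<in> borel_measurable borel"
    using lin by (simp add: borel_measurable_continuous_onI linear_continuous_on linear_conv_bounded_linear)
  fix A assume "A \<in> sets (distr lborel borel f)"
  then have [measurable]: "A \<in> sets borel" by simp
  let ?B = "cball 0 1 :: 'a set"
  have [measurable]: "?B \<in> sets borel" by simp
  have surj: "\<exists>y'. y = f y'" for y
    using orthogonal_transformation_surj[OF f] by (meson surj_def)
  have 1: "(\<integral>\<^sup>+x. indicator A (f x) \<partial>lborel) = (\<integral>\<^sup>+x. indicator A (f x + y) \<partial>lborel)" for y
  proof -
    obtain y' where "y = f y'" using surj by blast
    then show ?thesis
      using nn_integral_lborel_translate[of "\<lambda>x. indicator A (f x)" y'] lin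
      by (simp add: linear_add add.commute)
  qed
  have 2: "(\<integral>\<^sup>+y. indicator A (f x + y) * indicator ?B y \<partial>lborel) =
    (\<integral>\<^sup>+y. indicator A y * indicator ?B (y - f x) \<partial>lborel)" for x
    using nn_integral_lborel_translate[of "\<lambda>y. indicator A y * indicator ?B (y - f x)" "f x"]
    by simp
  \<comment> \<open>With \<open>y = f y'\<close>, the vector \<open>y - f x = f (y' - x)\<close> has
    the same norm as \<open>y' - x\<close>, so \<open>f\<close> disappears from the ball.\<close>
  have 3: "(\<integral>\<^sup>+x. indicator ?B (y - f x) \<partial>lborel) = emeasure lborel ?B" for y
  proof -
    obtain y' where y: "y = f y'" using surj by blast
    have "indicator ?B (y - f x) = (indicator ?B (- y' + x) :: ennreal)" for x
      using orthogonal_transformation_norm[OF f, of "y' - x"]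
      by (simp add: y indicator_def linear_diff[OF lin, symmetric] norm_minus_commute)
    then show ?thesis
      using nn_integral_lborel_translate[of "indicator ?B" "-y'"] by (simp add: )
  qed
  \<comment> \<open>Shifting \<open>x\<close> so that \<open>f x\<close> becomes
    \<open>f x + y\<close>, and then \<open>y\<close> by \<open>- f x\<close>, moves
    \<open>f\<close> from the argument of \<open>A\<close> to that of the ball, where it is
    harmless. The mass of the ball is positive and finite and can then be cancelled.\<close>
  have "emeasure (distr lborel borel f) A * emeasure lborel ?B
      = (\<integral>\<^sup>+y. (\<integral>\<^sup>+x. indicator A (f x) * indicator ?B y \<partial>lborel) \<partial>lborel)"
    by (simp add: nn_integral_multc nn_integral_cmult emeasure_distr nn_integral_distr flip: nn_integral_indicator)
  also have "\<dots> = (\<integral>\<^sup>+y. (\<integral>\<^sup>+x. indicator A (f x + y) * indicator ?B y \<partial>lborel) \<partial>lborel)"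
    by (simp add: nn_integral_multc 1[symmetric])
  also have "\<dots> = (\<integral>\<^sup>+x. (\<integral>\<^sup>+y. indicator A (f x + y) * indicator ?B y \<partial>lborel) \<partial>lborel)"
    by (rule lborel_pair.Fubini') measurable
  also have "\<dots> = (\<integral>\<^sup>+x. (\<integral>\<^sup>+y. indicator A y * indicator ?B (y - f x) \<partial>lborel) \<partial>lborel)"
    by (simp add: 2)
  also have "\<dots> = (\<integral>\<^sup>+y. (\<integral>\<^sup>+x. indicator A y * indicator ?B (y - f x) \<partial>lborel) \<partial>lborel)"
    by (rule lborel_pair.Fubini') measurable
  also have "\<dots> = emeasure lborel A * emeasure lborel ?B"
    by (simp add: nn_integral_multc nn_integral_cmult 3)
  finally have "emeasure lborel ?B * emeasure (distr lborel borel f) A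
      = emeasure lborel ?B * emeasure lborel A" by (simp add: mult.commute)
  moreover have "emeasure lborel ?B \<noteq> 0" "emeasure lborel ?B \<noteq> \<infinity>"
    using emeasure_lborel_cball_finite[of "0::'a" 1] 
    by (auto simp: emeasure_cball unit_ball_vol_pos less_imp_neq[symmetric])
  ultimately show "emeasure (distr lborel borel f) A = emeasure lborel A"
    by (simp add: ennreal_mult_cancel_left)
qed simp

text \<open>
  Integration along \<open>e\<close> and over the hyperplane orthogonal to \<open>e\<close>; averaging over a slab of unit
  thickness replaces Lebesgue measure on the hyperplane.
\<close>

lemma nn_integral_slab:
  fixes e :: "'a::euclidean_space" and G :: "'a \<Rightarrow> ennreal"
  assumes [measurable]: "G \<in> borel_measurable borel" and e: "norm e = 1"
  shows "(\<integral>\<^sup>+z. G z \<partial>lborel) =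
    (\<integral>\<^sup>+y. indicator {y. \<bar>y \<bullet> e\<bar> \<le> 1/2} y *
        (\<integral>\<^sup>+t. G ((y - (y \<bullet> e) *\<^sub>R e) + t *\<^sub>R e) \<partial>lborel) \<partial>lborel)"
proof -
  let ?I = "\<lambda>r::real. indicator {-(1/2)..1/2} r :: ennreal"
  have ind: "indicator {y. \<bar>y \<bullet> e\<bar> \<le> 1/2} y = ?I (y \<bullet> e)" for y
    by (auto simp: indicator_def)
  have ee: "e \<bullet> e = 1" using e by (simp add: dot_square_norm)
  \<comment> \<open>Translating \<open>t\<close> along the line absorbs the component of
    \<open>y\<close> in the direction \<open>e\<close>.\<close>
  have 1: "(\<integral>\<^sup>+t. G ((y - (y \<bullet> e) *\<^sub>R e) + t *\<^sub>R e) \<partial>lborel) = (\<integral>\<^sup>+t. G (y + t *\<^sub>R e) \<partial>lborel)" for y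
    using nn_integral_lborel_translate[of "\<lambda>t. G ((y - (y \<bullet> e) *\<^sub>R e) + t *\<^sub>R e)" "y \<bullet> e"]
    by (simp add: scaleR_add_left)
  have 2: "(\<integral>\<^sup>+y. ?I (y \<bullet> e) * G (y + t *\<^sub>R e) \<partial>lborel) = (\<integral>\<^sup>+y. ?I (y \<bullet> e - t) * G y \<partial>lborel)" for t
    using nn_integral_lborel_translate[of "\<lambda>y. ?I (y \<bullet> e - t) * G y" "t *\<^sub>R e"]
    by (simp add: inner_add_left ee add.commute)
  \<comment> \<open>Every line parallel to \<open>e\<close> meets the slab in a segment of length 1,
    so after the shift and the exchange of integrals the slab weight integrates to 1.\<close>
  have 3: "(\<integral>\<^sup>+t. ?I (r - t) \<partial>lborel) = 1" for r
  proof -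
    have "?I (r - t) = indicator {r-1/2..r+1/2} t" for t by (auto simp: indicator_def)
    then show ?thesis by simp
  qed
  have "(\<integral>\<^sup>+y. ?I (y \<bullet> e) * (\<integral>\<^sup>+t. G ((y - (y \<bullet> e) *\<^sub>R e) + t *\<^sub>R e) \<partial>lborel) \<partial>lborel)
    = (\<integral>\<^sup>+y. (\<integral>\<^sup>+t. ?I (y \<bullet> e) * G (y + t *\<^sub>R e) \<partial>lborel) \<partial>lborel)"
    unfolding 1 by (simp add: nn_integral_cmult)
  also have "\<dots> = (\<integral>\<^sup>+t. (\<integral>\<^sup>+y. ?I (y \<bullet> e) * G (y + t *\<^sub>R e) \<partial>lborel) \<partial>lborel)"
    by (rule lborel_pair.Fubini') measurable
  also have "\<dots> = (\<integral>\<^sup>+t. (\<integral>\<^sup>+y. ?I (y \<bullet> e - t) * G y \<partial>lborel) \<partial>lborel)"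
    unfolding 2 ..
  also have "\<dots> = (\<integral>\<^sup>+y. (\<integral>\<^sup>+t. ?I (y \<bullet> e - t) * G y \<partial>lborel) \<partial>lborel)"
    by (rule lborel_pair.Fubini') measurable
  also have "\<dots> = (\<integral>\<^sup>+y. G y \<partial>lborel)"
    by (simp add: nn_integral_multc 3)
  finally show ?thesis unfolding ind ..
qed

section \<open>Second moments of a disc\<close>

text \<open>This is the orthogonal projection onto the hyperplane orthogonal to \<open>e\<close>
  when \<open>e\<close> is a unit vector.\<close>

definition proj_perp :: "'a::real_inner \<Rightarrow> 'a \<Rightarrow> 'a"
  where "proj_perp e y = y - (y \<bullet> e) *\<^sub>R e"

text \<open>
  The cylinder of height 1 over the unit disc of the hyperplane orthogonal to \<open>e\<close>: integrating a function
  of \<open>proj_perp e y\<close> over it amounts to integrating over the disc.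
\<close>

definition cyl :: "'a::real_inner \<Rightarrow> 'a set"
  where "cyl e = {y. \<bar>y \<bullet> e\<bar> \<le> 1/2 \<and> norm (proj_perp e y) \<le> 1}"

text \<open>For \<open>v = 0\<close> the quotient is 0 by convention and the map is the identity, so
  it is orthogonal for every \<open>v\<close>.\<close>

definition reflection :: "'a::real_inner \<Rightarrow> 'a \<Rightarrow> 'a"
  where "reflection v x = x - (2 * (v \<bullet> x) / (v \<bullet> v)) *\<^sub>R v"

lemma linear_proj_perp: "linear (proj_perp e)"
  unfolding proj_perp_def
  by (rule linearI) (simp_all add: algebra_simps)

lemma continuous_on_proj_perp [continuous_intros]: "continuous_on S (proj_perp e)"
  unfolding proj_perp_def by (intro continuous_intros)

lemma borel_measurable_proj_perp [measurable]:
  "proj_perp (e::'a::euclidean_space) \<in> borel_measurable borel"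
  by (intro borel_measurable_continuous_onI continuous_intros)

lemma inner_proj_perp: "a \<bullet> proj_perp e y = proj_perp e a \<bullet> y"
  by (simp add: proj_perp_def inner_diff_left inner_diff_right inner_commute)

lemma proj_perp_inner: "norm e = 1 \<Longrightarrow> proj_perp e y \<bullet> e = 0"
  by (simp add: proj_perp_def inner_diff_left dot_square_norm)

lemma proj_perp_eq_self: "y \<bullet> e = 0 \<Longrightarrow> proj_perp e y = y"
  by (simp add: proj_perp_def)

lemma norm_proj_perp_sq:
  "norm e = 1 \<Longrightarrow> (norm (proj_perp e y))\<^sup>2 = (norm y)\<^sup>2 - (y \<bullet> e)\<^sup>2"
  unfolding proj_perp_def power2_norm_eq_inner norm_eq_1
  by (simp add: inner_diff_left inner_diff_right inner_commute power2_eq_square)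

lemma closed_cyl: "closed (cyl e)"
proof -
  have "cyl e = {y. \<bar>y \<bullet> e\<bar> \<le> 1/2} \<inter> {y. norm (proj_perp e y) \<le> 1}"
    by (auto simp: cyl_def)
  then show ?thesis
    by (auto intro!: closed_Int closed_Collect_le continuous_intros)
qed

lemma norm_cyl_le:
  assumes "norm e = 1" "y \<in> cyl e" shows "norm y \<le> 2"
proof -
  have "y = proj_perp e y + (y \<bullet> e) *\<^sub>R e" by (simp add: proj_perp_def)
  then have "norm y \<le> norm (proj_perp e y) + norm ((y \<bullet> e) *\<^sub>R e)"
    by (metis norm_triangle_ineq)
  then show ?thesis using assms by (simp add: cyl_def)
qed

lemma compact_cyl:
  "norm (e::'a::euclidean_space) = 1 \<Longrightarrow> compact (cyl e)"
  using norm_cyl_le[of e] by (auto simp: compact_eq_bounded_closed closed_cyl bounded_iff)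

lemma set_integrable_cyl:
  fixes e :: "'a::euclidean_space" and f :: "'a \<Rightarrow> real"
  assumes "norm e = 1" "continuous_on UNIV f"
  shows "set_integrable lborel (cyl e) f"
  unfolding set_integrable_def
  by (rule borel_integrable_compact[OF compact_cyl[OF assms(1)]])
     (rule continuous_on_subset[OF assms(2)], simp)

section \<open>Reflections and invariance of disc integrals\<close>

lemma orthogonal_reflection: "orthogonal_transformation (reflection v)"
  unfolding orthogonal_transformation_def
proof (intro conjI allI)
  show "linear (reflection v)"
    unfolding reflection_def
    by (rule linearI) (simp_all add: algebra_simps add_divide_distrib inner_add_right)
  show "reflection v x \<bullet> reflection v y = x \<bullet> y" for x y
    by (cases "v = 0")
       (simp_all add: reflection_def inner_diff_left inner_diff_right inner_commute field_simps)
qed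

text \<open>Equal norms make the mirror the bisecting hyperplane of \<open>a\<close> and
  \<open>b\<close>: with \<open>v = a - b\<close> one has
  \<open>v \<bullet> v = 2 * (v \<bullet> a)\<close>, so exactly \<open>v\<close> is subtracted from
  \<open>a\<close>.\<close>

lemma reflection_swap:
  assumes "norm a = norm b" shows "reflection (a - b) a = b"
proof (cases "a = b")
  case False
  have "(a - b) \<bullet> (a - b) = 2 * ((a - b) \<bullet> a)"
    using assms by (simp add: inner_diff_left inner_diff_right inner_commute norm_eq)
  moreover have "(a - b) \<bullet> (a - b) \<noteq> 0" using False by simp
  ultimately show ?thesis by (simp add: reflection_def)
qed (simp add: reflection_def)

lemma reflection_fixes: "v \<bullet> e = 0 \<Longrightarrow> reflection v e = e"
  by (simp add: reflection_def)

text \<open>The map \<open>f\<close> carries \<open>cyl e\<close> onto \<open>cyl (f e)\<close>,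
  intertwines the two projections and preserves Lebesgue measure.\<close>

lemma integral_cyl_orthogonal:
  fixes f :: "'a::euclidean_space \<Rightarrow> 'a" and g :: "'a \<Rightarrow> real"
  assumes f: "orthogonal_transformation f" and [measurable]: "g \<in> borel_measurable borel"
  shows "(LINT y:cyl (f e)|lborel. g (proj_perp (f e) y)) = (LINT y:cyl e|lborel. g (f (proj_perp e y)))"
proof -
  have lin: "linear f" using f by (simp add: orthogonal_transformation_linear)
  have [measurable]: "f \<in> borel_measurable borel"
    using lin by (simp add: borel_measurable_continuous_onI linear_continuous_on linear_conv_bounded_linear)
  have [measurable]: "cyl (f e) \<in> sets borel" by (rule borel_closed[OF closed_cyl])
  have inn: "f y \<bullet> f e = y \<bullet> e" for y
    using f by (simp add: orthogonal_transformation_def)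
  have proj: "proj_perp (f e) (f y) = f (proj_perp e y)" for y
    by (simp add: proj_perp_def inn linear_diff[OF lin] linear_scale[OF lin])
  have mem: "f y \<in> cyl (f e) \<longleftrightarrow> y \<in> cyl e" for y
    by (simp add: cyl_def inn proj orthogonal_transformation_norm[OF f])
  have "(LINT y:cyl (f e)|lborel. g (proj_perp (f e) y)) =
      (LINT y|distr lborel borel f. indicator (cyl (f e)) y *\<^sub>R g (proj_perp (f e) y))"
    by (simp add: distr_lborel_orthogonal[OF f] set_lebesgue_integral_def)
  also have "\<dots> = (LINT y|lborel. indicator (cyl (f e)) (f y) *\<^sub>R g (proj_perp (f e) (f y)))"
    by (rule integral_distr) simp_all
  also have "\<dots> = (LINT y:cyl e|lborel. g (f (proj_perp e y)))"
    by (simp add: proj set_lebesgue_integral_def indicator_def mem)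
  finally show ?thesis .
qed

section \<open>Isotropy of the second moments\<close>

definition cyl_moment :: "'a::euclidean_space \<Rightarrow> 'a \<Rightarrow> real"
  where "cyl_moment e a = (LINT y:cyl e|lborel. (a \<bullet> proj_perp e y)\<^sup>2)"

lemma cyl_moment_orthogonal:
  fixes f :: "'a::euclidean_space \<Rightarrow> 'a"
  assumes f: "orthogonal_transformation f"
  shows "cyl_moment (f e) (f a) = cyl_moment e a"
  using integral_cyl_orthogonal[OF f, of "\<lambda>y. (f a \<bullet> y)\<^sup>2" e] f
  by (simp add: cyl_moment_def orthogonal_transformation_def)

lemma cyl_moment_scale: "cyl_moment e (r *\<^sub>R a) = r\<^sup>2 * cyl_moment e a"
  by (simp add: cyl_moment_def power_mult_distrib)

lemma cyl_moment_proj_perp: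
  "norm e = 1 \<Longrightarrow> cyl_moment e (proj_perp e a) = cyl_moment e a"
  unfolding cyl_moment_def
  by (metis inner_proj_perp proj_perp_eq_self proj_perp_inner)

text \<open>The reflection exchanging \<open>a\<close> and \<open>b\<close> fixes \<open>e\<close>,
  because \<open>a - b\<close> is orthogonal to \<open>e\<close>; hence it preserves the
  disc.\<close>

lemma cyl_moment_unit_perp:
  fixes e :: "'a::euclidean_space"
  assumes "norm a = 1" "norm b = 1" "a \<bullet> e = 0" "b \<bullet> e = 0"
  shows "cyl_moment e a = cyl_moment e b"
  using cyl_moment_orthogonal[OF orthogonal_reflection, of "a - b" e a] assms
  by (simp add: reflection_swap reflection_fixes inner_diff_left)

text \<open>The moment sees only the part of \<open>a\<close> orthogonal to \<open>e\<close> and is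
  homogeneous of degree 2 in it, so the unit case decides everything.\<close>

lemma cyl_moment_eq:
  fixes e :: "'a::euclidean_space"
  assumes e: "norm e = 1" and b: "norm b = 1" "b \<bullet> e = 0"
  shows "cyl_moment e a = cyl_moment e b * (norm (proj_perp e a))\<^sup>2"
proof (cases "proj_perp e a = 0")
  case True
  then show ?thesis
    using cyl_moment_proj_perp[OF e, of a] by (simp add: cyl_moment_def)
next
  case False
  let ?p = "proj_perp e a"
  have "cyl_moment e a = cyl_moment e (norm ?p *\<^sub>R (?p /\<^sub>R norm ?p))"
    using False by (simp add: cyl_moment_proj_perp[OF e])
  also have "\<dots> = (norm ?p)\<^sup>2 * cyl_moment e (?p /\<^sub>R norm ?p)"
    by (rule cyl_moment_scale)
  also have "cyl_moment e (?p /\<^sub>R norm ?p) = cyl_moment e b"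
    by (rule cyl_moment_unit_perp) (use False b in \<open>simp_all add: proj_perp_inner[OF e]\<close>)
  finally show ?thesis by simp
qed

text \<open>The sum is the trace of an orthogonal projection of rank
  \<open>DIM('a) - 1\<close>.\<close>

lemma sum_norm_proj_perp_Basis:
  fixes e :: "'a::euclidean_space"
  assumes e: "norm e = 1"
  shows "(\<Sum>i\<in>Basis. (norm (proj_perp e i))\<^sup>2) = real DIM('a) - 1"
proof -
  have "(\<Sum>i\<in>Basis. (i \<bullet> e)\<^sup>2) = (norm e)\<^sup>2"
    unfolding power2_norm_eq_inner by (subst euclidean_inner) (simp add: inner_commute power2_eq_square)
  then show ?thesis by (simp add: norm_proj_perp_sq[OF e] sum_subtractf e)
qed

lemma sum_cyl_moment_Basis:
  fixes e :: "'a::euclidean_space"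
  assumes e: "norm e = 1"
  shows "(\<Sum>i\<in>Basis. cyl_moment e i) = (LINT y:cyl e|lborel. (norm (proj_perp e y))\<^sup>2)"
proof -
  have "(norm z)\<^sup>2 = (\<Sum>i\<in>Basis. (i \<bullet> z)\<^sup>2)" for z :: 'a
    unfolding power2_norm_eq_inner by (subst euclidean_inner) (simp add: inner_commute power2_eq_square)
  moreover have "set_integrable lborel (cyl e) (\<lambda>y. (i \<bullet> proj_perp e y)\<^sup>2)" for i
    by (intro set_integrable_cyl[OF e] continuous_intros)
  ultimately show ?thesis
    unfolding cyl_moment_def set_lebesgue_integral_def set_integrable_def
    by (subst Bochner_Integration.integral_sum[symmetric]) (simp_all add: sum_distrib_left)
qed

text \<open>The vector \<open>b\<close> witnesses that the hyperplane is nontrivial. A small ball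
  around \<open>b / 2\<close> lies in the cylinder, and the projection stays away from 0 on it. This
  positivity is what makes the final constant positive.\<close>

lemma integral_cyl_norm_pos:
  fixes e :: "'a::euclidean_space"
  assumes e: "norm e = 1" and b: "norm b = 1" "b \<bullet> e = 0"
  shows "0 < (LINT y:cyl e|lborel. (norm (proj_perp e y))\<^sup>2)"
proof -
  \<comment> \<open>Radius 1/4 around a point of norm 1/2 in the hyperplane gives
    \<open>\<bar>y \<bullet> e\<bar> \<le> 1/4\<close> and keeps the norm of the projection between
    1/4 and 3/4.\<close>
  let ?S = "ball (b /\<^sub>R 2) (1/4)"
  have sub: "y \<in> cyl e \<and> 1/16 \<le> (norm (proj_perp e y))\<^sup>2" if "y \<in> ?S" for y
  proof -
    let ?d = "y - b /\<^sub>R 2"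
    have d: "norm ?d \<le> 1/4" using that by (simp add: dist_norm norm_minus_commute)
    have "\<bar>?d \<bullet> e\<bar> \<le> norm ?d" using Cauchy_Schwarz_ineq2[of ?d e] e by simp
    moreover have "?d \<bullet> e = y \<bullet> e" using b by (simp add: inner_diff_left)
    ultimately have 1: "\<bar>y \<bullet> e\<bar> \<le> 1/4" using d by simp
    have "(norm (proj_perp e ?d))\<^sup>2 \<le> (norm ?d)\<^sup>2" by (simp add: norm_proj_perp_sq[OF e])
    then have "norm (proj_perp e ?d) \<le> 1/4" using d by (smt (verit) norm_ge_zero power2_le_imp_le)
    moreover have "proj_perp e ?d = proj_perp e y - b /\<^sub>R 2"
      using b by (simp add: proj_perp_def inner_diff_left)
    ultimately have 2: "norm (proj_perp e y - b /\<^sub>R 2) \<le> 1/4" by simp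
    have n: "norm (b /\<^sub>R 2) = 1/2" using b by simp
    have "norm (proj_perp e y) \<le> 3/4" "1/4 \<le> norm (proj_perp e y)"
      using 2 n norm_triangle_ineq2[of "proj_perp e y" "b /\<^sub>R 2"]
        norm_triangle_ineq3[of "proj_perp e y" "b /\<^sub>R 2"] by linarith+
    moreover from this(2) have "(1/4)\<^sup>2 \<le> (norm (proj_perp e y))\<^sup>2" by (intro power_mono) auto
    ultimately show ?thesis using 1 by (simp add: cyl_def power2_eq_square)
  qed
  have fin: "emeasure lborel ?S < \<infinity>" by (rule emeasure_lborel_ball_finite)
  have "measure lborel ?S > 0"
    by (simp add: content_ball_pos)
  then have "0 < (LINT y|lborel. indicator ?S y * (1/16::real))"
    by simp
  also have "\<dots> \<le> (LINT y:cyl e|lborel. (norm (proj_perp e y))\<^sup>2)"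
    unfolding set_lebesgue_integral_def
  proof (rule integral_mono)
    show "integrable lborel (\<lambda>y. indicator ?S y * (1/16::real))" using fin by simp
    show "integrable lborel (\<lambda>y. indicat_real (cyl e) y *\<^sub>R (norm (proj_perp e y))\<^sup>2)"
      unfolding set_integrable_def[symmetric]
      by (intro set_integrable_cyl[OF e] continuous_intros)
    show "indicator ?S y * (1/16::real) \<le> indicat_real (cyl e) y *\<^sub>R (norm (proj_perp e y))\<^sup>2" for y
      using sub[of y] by (auto simp: indicator_def)
  qed
  finally show ?thesis .
qed

text \<open>One constant serves all directions \<open>e\<close>. It is found by summing the moments
  over an orthonormal basis: the sum is the integral of the squared norm, which is the same for all
  unit vectors \<open>e\<close>, and it also equals the constant times the dimension of the
  hyperplane.\<close>

lemma cyl_moment_isotropic: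
  "\<exists>c>0. \<forall>e (a::'a::euclidean_space). norm e = 1 \<longrightarrow> cyl_moment e a = c * (norm (proj_perp e a))\<^sup>2"
proof (cases "\<exists>e b::'a. norm e = 1 \<and> norm b = 1 \<and> b \<bullet> e = 0")
  \<comment> \<open>Without an orthogonal pair of unit vectors the space is a line: the hyperplane
    is the origin, both sides vanish, and 1 serves as the constant.\<close>
  case False
  have "cyl_moment e a = 1 * (norm (proj_perp e a))\<^sup>2" if e: "norm e = 1" for e a :: 'a
  proof -
    have "proj_perp e y = 0" for y
    proof (rule ccontr)
      assume "proj_perp e y \<noteq> 0"
      with False e proj_perp_inner[OF e, of y]
      have "norm (proj_perp e y /\<^sub>R norm (proj_perp e y)) \<noteq> 1" 
        by (metis inner_scaleR_left mult_zero_right)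
      then show False using \<open>proj_perp e y \<noteq> 0\<close> by simp
    qed
    then show ?thesis by (simp add: cyl_moment_def)
  qed
  then show ?thesis by (intro exI[of _ 1]) auto
next
  case True
  then obtain e0 b0 :: 'a where e0: "norm e0 = 1" and b0: "norm b0 = 1" "b0 \<bullet> e0 = 0" by blast
  let ?M = "\<lambda>e::'a. LINT y:cyl e|lborel. (norm (proj_perp e y))\<^sup>2"
  have N: "real DIM('a) - 1 > 0"
  proof -
    have "e0 \<noteq> 0" "b0 \<noteq> 0" "b0 \<noteq> e0" using e0 b0 by (auto simp: dot_square_norm)
    then have "independent {b0, e0}"
      using b0 by (intro pairwise_orthogonal_independent)
        (auto simp: pairwise_def orthogonal_def inner_commute)
    then have "card {b0, e0} \<le> DIM('a)" by (rule independent_card_le)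
    then show ?thesis using \<open>b0 \<noteq> e0\<close> by simp
  qed
  \<comment> \<open>The reflection taking \<open>e0\<close> to \<open>e\<close> preserves the norm,
    so the integral does not depend on the direction.\<close>
  have M: "?M e = ?M e0" if "norm e = 1" for e :: 'a
    using integral_cyl_orthogonal[OF orthogonal_reflection, of "\<lambda>y. (norm y)\<^sup>2" "e0 - e" e0]
      that e0 orthogonal_transformation_norm[OF orthogonal_reflection, of "e0 - e"]
    by (simp add: reflection_swap)
  have "cyl_moment e a = ?M e0 / (real DIM('a) - 1) * (norm (proj_perp e a))\<^sup>2" if e: "norm e = 1" for e a :: 'a
  proof -
    \<comment> \<open>The same reflection transports the reference vector \<open>b0\<close> to a
      unit vector orthogonal to \<open>e\<close>.\<close>
    have "\<exists>b. norm b = 1 \<and> b \<bullet> e = 0"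
    proof -
      let ?f = "reflection (e0 - e)"
      have "?f e0 = e" using e e0 by (simp add: reflection_swap)
      then have "?f b0 \<bullet> e = b0 \<bullet> e0"
        using orthogonal_reflection[of "e0 - e"] by (metis orthogonal_transformation_def)
      moreover have "norm (?f b0) = norm b0"
        by (rule orthogonal_transformation_norm[OF orthogonal_reflection])
      ultimately have "?f b0 \<bullet> e = 0" "norm (?f b0) = 1" using b0 by simp_all
      then show ?thesis by blast
    qed
    then obtain b where b: "norm b = 1" "b \<bullet> e = 0" by blast
    have "?M e = (\<Sum>i\<in>Basis. cyl_moment e b * (norm (proj_perp e i))\<^sup>2)"
      unfolding sum_cyl_moment_Basis[OF e, symmetric]
      by (intro sum.cong refl cyl_moment_eq[OF e b])
    also have "\<dots> = cyl_moment e b * (real DIM('a) - 1)"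
      by (simp add: sum_distrib_left[symmetric] sum_norm_proj_perp_Basis[OF e])
    finally have "cyl_moment e b = ?M e0 / (real DIM('a) - 1)"
      using N M[OF e] by (simp add: field_simps)
    then show ?thesis using cyl_moment_eq[OF e b, of a] by simp
  qed
  moreover have "?M e0 / (real DIM('a) - 1) > 0"
    using N integral_cyl_norm_pos[OF e0 b0] by simp
  ultimately show ?thesis by blast
qed

text \<open>Polarisation of the isotropy identity.\<close>

lemma integral_cyl_product:
  fixes e :: "'a::euclidean_space"
  assumes e: "norm e = 1" and c: "\<And>a. cyl_moment e a = c * (norm (proj_perp e a))\<^sup>2"
  shows "(LINT y:cyl e|lborel. (a \<bullet> proj_perp e y) * (b \<bullet> proj_perp e y))
    = c * (proj_perp e a \<bullet> proj_perp e b)"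
proof -
  let ?q = "\<lambda>a y. (a \<bullet> proj_perp e y)\<^sup>2"
  have int: "set_integrable lborel (cyl e) (?q a)" for a
    by (intro set_integrable_cyl[OF e] continuous_intros)
  have "(LINT y:cyl e|lborel. (a \<bullet> proj_perp e y) * (b \<bullet> proj_perp e y))
    = (LINT y:cyl e|lborel. (?q (a + b) y - ?q (a - b) y) / 4)"
    by (simp add: inner_add_left inner_diff_left power2_eq_square algebra_simps)
  also have "\<dots> = (cyl_moment e (a + b) - cyl_moment e (a - b)) / 4"
    unfolding cyl_moment_def by (subst set_integral_diff(2)[OF int int, symmetric]) simp
  also have "\<dots> = c * (proj_perp e a \<bullet> proj_perp e b)"
    by (simp add: c linear_add[OF linear_proj_perp] linear_diff[OF linear_proj_perp]
      power2_norm_eq_inner inner_add_left inner_diff_left inner_add_right inner_diff_right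
      inner_commute algebra_simps)
  finally show ?thesis .
qed

text \<open>The right-hand side is \<open>c\<close> times the trace of \<open>H\<close> on the
  hyperplane: the full trace less the entry in the direction \<open>e\<close>.\<close>

lemma integral_cyl_quadratic:
  fixes e :: "'a::euclidean_space" and H :: "'a \<Rightarrow> 'a"
  assumes e: "norm e = 1" and c: "\<And>a. cyl_moment e a = c * (norm (proj_perp e a))\<^sup>2"
    and H: "linear H"
  shows "(LINT y:cyl e|lborel. proj_perp e y \<bullet> H (proj_perp e y))
    = c * ((\<Sum>i\<in>Basis. i \<bullet> H i) - e \<bullet> H e)"
proof -
  \<comment> \<open>The adjoint turns each summand into a product of two linear functionals of
    \<open>z\<close>, the form that the polarised identity integrates.\<close>
  have quad: "z \<bullet> H z = (\<Sum>i\<in>Basis. (i \<bullet> z) * (adjoint H i \<bullet> z))" for z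
    by (subst euclidean_inner) (simp add: adjoint_works[OF H] adjoint_linear[OF H] inner_commute)
  have int: "set_integrable lborel (cyl e) (\<lambda>y. (i \<bullet> proj_perp e y) * (adjoint H i \<bullet> proj_perp e y))" for i
    by (intro set_integrable_cyl[OF e] continuous_intros)
  have "(LINT y:cyl e|lborel. proj_perp e y \<bullet> H (proj_perp e y)) =
      (\<Sum>i\<in>Basis. (LINT y:cyl e|lborel. (i \<bullet> proj_perp e y) * (adjoint H i \<bullet> proj_perp e y)))"
    unfolding quad using int unfolding set_lebesgue_integral_def set_integrable_def
    by (subst Bochner_Integration.integral_sum[symmetric]) (simp_all add: sum_distrib_left)
  also have "\<dots> = (\<Sum>i\<in>Basis. c * (proj_perp e i \<bullet> proj_perp e (adjoint H i)))"
    by (simp add: integral_cyl_product[OF e c])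
  also have "\<dots> = (\<Sum>i\<in>Basis. c * (proj_perp e i \<bullet> adjoint H i))"
    by (metis inner_proj_perp proj_perp_eq_self proj_perp_inner[OF e])
  also have "\<dots> = (\<Sum>i\<in>Basis. c * (i \<bullet> H i - (e \<bullet> i) * (H e \<bullet> i)))"
    unfolding adjoint_works[OF H]
    by (simp add: proj_perp_def linear_diff[OF H] linear_scale[OF H] inner_diff_left inner_diff_right inner_commute)
  also have "\<dots> = c * ((\<Sum>i\<in>Basis. i \<bullet> H i) - e \<bullet> H e)"
    by (subst (2) euclidean_inner) (simp add: sum_distrib_left[symmetric] sum_subtractf)
  finally show ?thesis .
qed

section \<open>Divergence of a normalised vector field\<close>

lemma trace_matrix_eq_sum_Basis:
  fixes f :: "real ^ 'n \<Rightarrow> real ^ 'n"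
  shows "trace (matrix f) = (\<Sum>b\<in>Basis. b \<bullet> f b)"
proof -
  have B: "(Basis :: (real^'n) set) = range (\<lambda>i. axis i 1)"
    by (auto simp: Basis_vec_def)
  have inj: "inj (\<lambda>i::'n. axis i (1::real))"
    by (auto simp: inj_def axis_eq_axis)
  show ?thesis unfolding B
    by (simp add: sum.reindex[OF inj] trace_def matrix_def inner_axis')
qed

text \<open>The derivative of \<open>norm (g y)\<close> at \<open>x\<close> is
  \<open>\<lambda>h. e \<bullet> H h\<close>, so by the product rule the normalised field has
  derivative \<open>D\<close> below, which removes from \<open>H h\<close> its component along
  \<open>e\<close> and divides by the norm. The trace of \<open>D\<close> is the claim.\<close>

lemma divergence_normalised:
  fixes g :: "real ^ 'n \<Rightarrow> real ^ 'n"
  assumes g: "(g has_derivative H) (at x)" and p: "g x \<noteq> 0"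
  defines "e \<equiv> g x /\<^sub>R norm (g x)"
  shows "divergence (\<lambda>y. g y /\<^sub>R norm (g y)) x = ((\<Sum>i\<in>Basis. i \<bullet> H i) - e \<bullet> H e) / norm (g x)"
proof -
  let ?r = "norm (g x)"
  have r: "?r > 0" using p by simp
  define D where "D h = H h /\<^sub>R ?r - ((e \<bullet> H h) / ?r) *\<^sub>R e" for h
  have n: "((\<lambda>y. norm (g y)) has_derivative (\<lambda>h. e \<bullet> H h)) (at x)"
    using has_derivative_compose[OF g has_derivative_norm[OF p]]
    by (simp add: e_def sgn_div_norm inner_commute)
  have "((\<lambda>y. g y /\<^sub>R norm (g y)) has_derivative D) (at x)"
    unfolding D_def
    by (rule has_derivative_eq_rhs[OF has_derivative_scaleR[OF Deriv.has_derivative_inverse[OF _ n] g]])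
       (use r in \<open>auto simp: e_def field_simps\<close>)
  then have "divergence (\<lambda>y. g y /\<^sub>R norm (g y)) x = (\<Sum>i\<in>Basis. i \<bullet> D i)"
    by (simp add: divergence_def jacobian_def frechet_derivative_at[symmetric] trace_matrix_eq_sum_Basis)
  also have "\<dots> = (\<Sum>i\<in>Basis. i \<bullet> H i) / ?r - (\<Sum>i\<in>Basis. (e \<bullet> H i) * (e \<bullet> i)) / ?r"
    by (simp add: D_def inner_diff_right sum_subtractf sum_distrib_left inner_commute divide_inverse ac_simps)
  \<comment> \<open>This is the coordinate expansion of the inner product of \<open>e\<close> and
    \<open>adjoint H e\<close>.\<close>
  also have "(\<Sum>i\<in>Basis. (e \<bullet> H i) * (e \<bullet> i)) = e \<bullet> H e"
  proof -
    have lin: "linear H" using g by (rule has_derivative_linear)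
    show ?thesis
      using euclidean_inner[of e "adjoint H e"] adjoint_works[OF lin]
      by (simp add: inner_commute mult.commute)
  qed
  finally show ?thesis by (simp add: diff_divide_distrib)
qed

section \<open>From volume asymptotics to singular masses\<close>

lemma nn_integral_powr_atLeast:
  assumes "\<beta> > 0" "a > 0"
  shows "(\<integral>\<^sup>+s. ennreal (\<beta> * s powr (-\<beta> - 1)) * indicator {a..} s \<partial>lborel) = ennreal (a powr - \<beta>)"
proof -
  have "(\<integral>\<^sup>+s. ennreal (\<beta> * s powr (-\<beta> - 1)) * indicator {a..} s \<partial>lborel) = ennreal (0 - (- (a powr - \<beta>)))"
  proof (rule nn_integral_FTC_atLeast)
    show "((\<lambda>s. - (s powr - \<beta>)) has_real_derivative \<beta> * s powr (-\<beta> - 1)) (at s)" if "a \<le> s" for s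
      using that assms by (auto intro!: derivative_eq_intros)
    show "((\<lambda>s. - (s powr - \<beta>)) \<longlongrightarrow> 0) at_top"
      using tendsto_minus[OF tendsto_neg_powr[of "-\<beta>" "\<lambda>s. s" at_top]] assms by (simp add: filterlim_ident)
  qed (use assms in auto)
  then show ?thesis by simp
qed

text \<open>The weight has mass \<open>d powr (1 - \<alpha>)\<close> on \<open>{0..d}\<close>, which
  tends to 1 as \<alpha> tends to 1 for every fixed \<open>d > 0\<close>: this is the concentration
  at 0.\<close>

lemma nn_integral_powr_from_0:
  assumes "\<alpha> < 1" "d > 0"
  shows "(\<integral>\<^sup>+s. ennreal ((1 - \<alpha>) * s powr - \<alpha>) * indicator {0..d} s \<partial>lborel) = ennreal (d powr (1 - \<alpha>))"
proof -
  have "((\<lambda>s. (1 - \<alpha>) * s powr - \<alpha>) has_integral (1 - \<alpha>) * (d powr (- \<alpha> + 1) / (- \<alpha> + 1))) {0..d}"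
    using assms by (intro has_integral_mult_right has_integral_powr_from_0) auto
  then have "((\<lambda>s. (1 - \<alpha>) * s powr - \<alpha> * indicator {0..d} s) has_integral d powr (1 - \<alpha>)) UNIV"
    using assms by (subst (asm) has_integral_restrict_UNIV[symmetric])
      (simp add: indicator_def of_bool_def if_distrib cong: if_cong)
  then have "(\<integral>\<^sup>+s. ennreal ((1 - \<alpha>) * s powr - \<alpha> * indicator {0..d} s) \<partial>lborel) = ennreal (d powr (1 - \<alpha>))"
    using assms by (intro nn_integral_has_integral_lborel) (auto simp: indicator_def)
  then show ?thesis by (simp add: ennreal_mult'' ennreal_indicator)
qed

text \<open>The power of \<open>norm z\<close> is written as an integral over the radii
  \<open>s \<ge> norm z\<close>, and the order of integration is exchanged.\<close>

lemma nn_integral_layer_cake: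
  fixes E :: "'a::euclidean_space set"
  assumes [measurable]: "E \<in> sets borel" and b: "\<beta> > 0"
  shows "(\<integral>\<^sup>+z. ennreal (1 / norm z powr \<beta>) * indicator E z \<partial>lborel) =
    (\<integral>\<^sup>+s. ennreal (\<beta> * s powr (-\<beta> - 1)) * indicator {0<..} s * emeasure lborel (E \<inter> cball 0 s) \<partial>lborel)"
proof -
  let ?w = "\<lambda>s. ennreal (\<beta> * s powr (-\<beta> - 1)) * indicator {0<..} s"
  have [measurable]: "(\<lambda>(s, z::'a). indicator {p. norm (snd p) \<le> fst p} (s, z) :: ennreal)
      \<in> borel_measurable (lborel \<Otimes>\<^sub>M lborel)"
    by measurable
  have [measurable]: "cball (0::'a) s \<in> sets borel" for s by simp
  have ind: "indicator {p. norm (snd p) \<le> fst p} (s, z) = (indicator (cball 0 s) z :: ennreal)" for s and z :: 'a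
    by (simp add: indicator_def)
  have pt: "ennreal (1 / norm z powr \<beta>) * indicator E z
      = (\<integral>\<^sup>+s. ?w s * (indicator {p. norm (snd p) \<le> fst p} (s, z) * indicator E z) \<partial>lborel)" if "z \<noteq> 0" for z :: 'a
  proof -
    have "ennreal (1 / norm z powr \<beta>) = (\<integral>\<^sup>+s. ennreal (\<beta> * s powr (-\<beta> - 1)) * indicator {norm z..} s \<partial>lborel)"
      using that b by (simp add: nn_integral_powr_atLeast powr_minus divide_inverse)
    also have "\<dots> = (\<integral>\<^sup>+s. ?w s * indicator {p. norm (snd p) \<le> fst p} (s, z) \<partial>lborel)"
    proof (rule nn_integral_cong)
      fix s :: real
      have "norm z \<le> s \<Longrightarrow> 0 < s" using that by (meson less_le_trans zero_less_norm_iff)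
      then show "ennreal (\<beta> * s powr (-\<beta> - 1)) * indicator {norm z..} s
         = ?w s * indicator {p. norm (snd p) \<le> fst p} (s, z)"
        by (auto simp: indicator_def)
    qed
    finally show ?thesis
      by (subst mult.assoc[symmetric], subst nn_integral_multc) simp_all
  qed
  \<comment> \<open>At the origin the density is 0 by the convention for division while the integral
    over radii diverges; this single point is a null set.\<close>
  have "AE z in lborel. z \<noteq> (0::'a)" by (rule AE_lborel_singleton)
  then have "(\<integral>\<^sup>+z. ennreal (1 / norm z powr \<beta>) * indicator E z \<partial>lborel) =
      (\<integral>\<^sup>+z. (\<integral>\<^sup>+s. ?w s * (indicator {p. norm (snd p) \<le> fst p} (s, z) * indicator E z) \<partial>lborel) \<partial>lborel)"
    by (intro nn_integral_cong_AE) (auto simp: pt elim!: eventually_mono)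
  also have "\<dots> = (\<integral>\<^sup>+s. (\<integral>\<^sup>+z. ?w s * (indicator {p. norm (snd p) \<le> fst p} (s, z) * indicator E z) \<partial>lborel) \<partial>lborel)"
    by (rule lborel_pair.Fubini') measurable
  also have "\<dots> = (\<integral>\<^sup>+s. ?w s * emeasure lborel (E \<inter> cball 0 s) \<partial>lborel)"
    unfolding ind by (subst nn_integral_cmult) (simp_all add: Int_commute flip: indicator_inter_arith)
  finally show ?thesis .
qed

text \<open>As \<open>\<alpha> \<rightarrow> 1\<close>, the weight \<open>(1 - \<alpha>) s\<^bsup>-\<alpha>\<^esup>\<close> concentrates at \<open>s = 0\<close>.\<close>

lemma tendsto_abelian:
  fixes \<phi> :: "real \<Rightarrow> real" and n :: real
  assumes [measurable]: "\<phi> \<in> borel_measurable borel" and n: "n > 0"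
    and nonneg: "\<And>s. s > 0 \<Longrightarrow> 0 \<le> \<phi> s" and bound: "\<And>s. s > 0 \<Longrightarrow> \<phi> s \<le> M / s"
    and lim: "(\<phi> \<longlongrightarrow> L) (at_right 0)"
  shows "((\<lambda>\<alpha>. \<integral>\<^sup>+s. ennreal ((1 - \<alpha>) * (n + \<alpha>) * s powr - \<alpha> * \<phi> s) * indicator {0<..} s \<partial>lborel)
    \<longlongrightarrow> ennreal ((n + 1) * L)) (at_left 1)" (is "(?I \<longlongrightarrow> _) _")
proof -
  have L0: "0 \<le> L"
    using tendsto_lowerbound[OF lim] nonneg by (simp add: eventually_at_right_less eventually_at_filter)
  have M0: "0 \<le> M" using nonneg[of 1] bound[of 1] by simp
  have ev: "eventually (\<lambda>\<alpha>::real. 0 < \<alpha> \<and> \<alpha> < 1) (at_left 1)"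
    using eventually_at_left_real[of 0 "1::real"] by (auto elim!: eventually_mono)
  have main: "eventually (\<lambda>\<alpha>. ?I \<alpha> < \<infinity> \<and> dist (enn2real (?I \<alpha>)) ((n + 1) * L) < \<eta>) (at_left 1)"
    if eta: "\<eta> > 0" for \<eta>
  proof -
    \<comment> \<open>With this choice \<open>(n + 1) * \<epsilon>\<close> is half of \<eta>, which
      leaves room for the strict inequalities obtained in the limit.\<close>
    define \<epsilon> where "\<epsilon> = \<eta> / (2 * (n + 1))"
    have eps: "\<epsilon> > 0" "(n + 1) * \<epsilon> < \<eta>" using eta n by (auto simp: \<epsilon>_def field_simps add_pos_pos)
    have "eventually (\<lambda>s. dist (\<phi> s) L < \<epsilon>) (at_right 0)"
      using lim eps by (simp add: tendsto_iff)
    then obtain d0 where d0: "d0 > 0" "\<And>s. 0 < s \<Longrightarrow> s < d0 \<Longrightarrow> dist (\<phi> s) L < \<epsilon>"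
      by (auto simp: eventually_at_right_field)
    define d where "d = d0 / 2"
    have d: "d > 0" "\<And>s. 0 < s \<Longrightarrow> s \<le> d \<Longrightarrow> \<bar>\<phi> s - L\<bar> \<le> \<epsilon>"
      using d0 by (force simp: d_def dist_real_def)+
    \<comment> \<open>Truncation at 0 keeps the lower bound nonnegative, so that products pass
      through \<open>ennreal\<close>.\<close>
    define l where "l = max 0 (L - \<epsilon>)"
    \<comment> \<open>On \<open>{0..d}\<close> the function \<phi> is within \<epsilon> of
      \<open>L\<close>; beyond \<open>d\<close> it is at most \<open>M / s\<close>. The second part
      carries the factor \<open>1 - \<alpha>\<close> without a compensating singularity at 0 and
      vanishes in the limit. The lower bound \<open>?V\<close> uses only the first region.\<close>
    let ?U = "\<lambda>\<alpha>. (n + \<alpha>) * (L + \<epsilon>) * d powr (1 - \<alpha>) + (1 - \<alpha>) * (n + \<alpha>) * M / \<alpha> * d powr - \<alpha>"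
    let ?V = "\<lambda>\<alpha>. (n + \<alpha>) * l * d powr (1 - \<alpha>)"
    have U: "?I \<alpha> \<le> ennreal (?U \<alpha>)" and V: "ennreal (?V \<alpha>) \<le> ?I \<alpha>" if a: "0 < \<alpha>" "\<alpha> < 1" for \<alpha>
    proof -
      let ?f = "\<lambda>s. ennreal ((1 - \<alpha>) * s powr - \<alpha>) * indicator {0..d} s"
      let ?g = "\<lambda>s. ennreal (\<alpha> * s powr (- \<alpha> - 1)) * indicator {d..} s"
      have "?I \<alpha> \<le> (\<integral>\<^sup>+s. ennreal ((n + \<alpha>) * (L + \<epsilon>)) * ?f s + ennreal ((1 - \<alpha>) * (n + \<alpha>) * M / \<alpha>) * ?g s \<partial>lborel)"
      proof (rule nn_integral_mono)
        fix s :: real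
        consider "s \<le> 0" | "0 < s" "s \<le> d" | "d < s" by linarith
        then show "ennreal ((1 - \<alpha>) * (n + \<alpha>) * s powr - \<alpha> * \<phi> s) * indicator {0<..} s
          \<le> ennreal ((n + \<alpha>) * (L + \<epsilon>)) * ?f s + ennreal ((1 - \<alpha>) * (n + \<alpha>) * M / \<alpha>) * ?g s"
        proof cases
          case 2
          then have "\<phi> s \<le> L + \<epsilon>" using d(2)[of s] by linarith
          then have "(1 - \<alpha>) * (n + \<alpha>) * s powr - \<alpha> * \<phi> s \<le> (1 - \<alpha>) * (n + \<alpha>) * s powr - \<alpha> * (L + \<epsilon>)"
            using a n by (intro mult_left_mono) auto
          also have "\<dots> = (n + \<alpha>) * (L + \<epsilon>) * ((1 - \<alpha>) * s powr - \<alpha>)" by simp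
          finally have "ennreal ((1 - \<alpha>) * (n + \<alpha>) * s powr - \<alpha> * \<phi> s) \<le>
              ennreal ((n + \<alpha>) * (L + \<epsilon>)) * ennreal ((1 - \<alpha>) * s powr - \<alpha>)"
            using a n L0 eps by (subst ennreal_mult[symmetric]) (auto intro!: ennreal_leI)
          then show ?thesis using 2 by (simp add: add_increasing2)
        next
          case 3
          then have s: "s > 0" using d by linarith
          have "(1 - \<alpha>) * (n + \<alpha>) * s powr - \<alpha> * \<phi> s \<le> (1 - \<alpha>) * (n + \<alpha>) * s powr - \<alpha> * (M / s)"
            using a n bound[OF s] by (intro mult_left_mono) auto
          also have "\<dots> = (1 - \<alpha>) * (n + \<alpha>) * M / \<alpha> * (\<alpha> * s powr (- \<alpha> - 1))"
            using a s by (simp add: powr_diff)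
          finally have "ennreal ((1 - \<alpha>) * (n + \<alpha>) * s powr - \<alpha> * \<phi> s) \<le>
              ennreal ((1 - \<alpha>) * (n + \<alpha>) * M / \<alpha>) * ennreal (\<alpha> * s powr (- \<alpha> - 1))"
            using a n M0 by (subst ennreal_mult[symmetric]) (auto intro!: ennreal_leI)
          then show ?thesis using 3 s by simp
        qed simp
      qed
      also have "\<dots> = ennreal ((n + \<alpha>) * (L + \<epsilon>)) * ennreal (d powr (1 - \<alpha>))
          + ennreal ((1 - \<alpha>) * (n + \<alpha>) * M / \<alpha>) * ennreal (d powr - \<alpha>)"
        using a d by (simp add: nn_integral_add nn_integral_cmult nn_integral_powr_from_0 nn_integral_powr_atLeast)
      also have "\<dots> = ennreal (?U \<alpha>)"
        using a n L0 M0 eps by (simp add: ennreal_mult[symmetric] ennreal_plus[symmetric] del: ennreal_plus)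
      finally show "?I \<alpha> \<le> ennreal (?U \<alpha>)" .
      have "ennreal (?V \<alpha>) = ennreal ((n + \<alpha>) * l) * (\<integral>\<^sup>+s. ?f s \<partial>lborel)"
        unfolding nn_integral_powr_from_0[OF a(2) d(1)]
        by (rule ennreal_mult) (use a n in \<open>auto simp: l_def\<close>)
      also have "\<dots> = (\<integral>\<^sup>+s. ennreal ((n + \<alpha>) * l) * ?f s \<partial>lborel)"
        by (rule nn_integral_cmult[symmetric]) measurable
      also have "\<dots> \<le> ?I \<alpha>"
      proof (rule nn_integral_mono)
        fix s :: real
        show "ennreal ((n + \<alpha>) * l) * ?f s \<le> ennreal ((1 - \<alpha>) * (n + \<alpha>) * s powr - \<alpha> * \<phi> s) * indicator {0<..} s"
        proof (cases "0 < s \<and> s \<le> d")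
          case True
          then have "l \<le> \<phi> s" using d(2)[of s] nonneg[of s] by (auto simp: l_def)
          then have "(n + \<alpha>) * ((1 - \<alpha>) * s powr - \<alpha>) * l \<le> (n + \<alpha>) * ((1 - \<alpha>) * s powr - \<alpha>) * \<phi> s"
            using a n by (intro mult_left_mono) auto
          then have "ennreal ((n + \<alpha>) * l) * ennreal ((1 - \<alpha>) * s powr - \<alpha>) \<le>
             ennreal ((1 - \<alpha>) * (n + \<alpha>) * s powr - \<alpha> * \<phi> s)"
            using a n by (subst ennreal_mult[symmetric]) (auto intro!: ennreal_leI simp: l_def ac_simps)
          then show ?thesis using True by simp
        qed (auto simp: indicator_def)
      qed
      finally show "ennreal (?V \<alpha>) \<le> ?I \<alpha>" .
    qed
    have "((\<lambda>\<alpha>. ?U \<alpha>) \<longlongrightarrow> (n + 1) * (L + \<epsilon>) * d powr (1 - 1) + (1 - 1) * (n + 1) * M / 1 * d powr - 1) (at_left 1)"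
      using d by (intro tendsto_intros) auto
    moreover have "(n + 1) * (L + \<epsilon>) * d powr (1 - 1) + (1 - 1) * (n + 1) * M / 1 * d powr - 1 < (n + 1) * L + \<eta>"
      using d eps by (simp add: algebra_simps)
    ultimately have evU: "eventually (\<lambda>\<alpha>. ?U \<alpha> < (n + 1) * L + \<eta>) (at_left 1)"
      by (rule order_tendstoD)
    have "((\<lambda>\<alpha>. ?V \<alpha>) \<longlongrightarrow> (n + 1) * l * d powr (1 - 1)) (at_left 1)"
      using d by (intro tendsto_intros) auto
    moreover have "(n + 1) * L - \<eta> < (n + 1) * l * d powr (1 - 1)"
    proof -
      have "(n + 1) * (L - \<epsilon>) \<le> (n + 1) * l" using n by (intro mult_left_mono) (auto simp: l_def)
      then show ?thesis using d eps by (simp add: algebra_simps)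
    qed
    ultimately have evV: "eventually (\<lambda>\<alpha>. (n + 1) * L - \<eta> < ?V \<alpha>) (at_left 1)"
      by (rule order_tendstoD)
    show ?thesis using ev evU evV
    proof eventually_elim
      case (elim \<alpha>)
      \<comment> \<open>Finiteness is carried along because \<open>enn2real\<close> would send an
        infinite integral to 0.\<close>
      have fin: "?I \<alpha> < \<infinity>" using U[of \<alpha>] elim by (auto simp: less_top[symmetric] top_unique)
      have "0 \<le> ?U \<alpha>" "0 \<le> ?V \<alpha>" using elim n L0 M0 eps by (auto simp: l_def)
      then have "enn2real (?I \<alpha>) \<le> ?U \<alpha>" "?V \<alpha> \<le> enn2real (?I \<alpha>)"
        using U[of \<alpha>] V[of \<alpha>] elim fin
        by (auto intro: enn2real_leI simp: enn2real_mono dest: enn2real_mono)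
      then show ?case using fin elim by (simp add: dist_real_def)
    qed
  qed
  have "((\<lambda>\<alpha>. enn2real (?I \<alpha>)) \<longlongrightarrow> (n + 1) * L) (at_left 1)"
    by (rule tendstoI, rule eventually_mono[OF main]) auto
  then have "((\<lambda>\<alpha>. ennreal (enn2real (?I \<alpha>))) \<longlongrightarrow> ennreal ((n + 1) * L)) (at_left 1)"
    by (rule tendsto_ennrealI)
  then show ?thesis
    by (rule Lim_transform_eventually, intro eventually_mono[OF main[of 1]]) auto
qed

section \<open>Volume between a graph and its tangent hyperplane\<close>

text \<open>The exceptional set lies in the frontier of a convex set, the preimage of the unit ball
  under a linear map, and such frontiers are negligible.\<close>

lemma AE_norm_proj_perp_neq:
  fixes e :: "'a::euclidean_space"
  shows "AE y in lborel. norm (proj_perp e y) \<noteq> 1"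
proof -
  let ?S = "proj_perp e -` cball 0 1" and ?T = "{y. norm (proj_perp e y) = 1}"
  have "convex ?S" by (intro convex_linear_vimage linear_proj_perp convex_cball)
  moreover have "?T \<subseteq> frontier ?S"
  proof
    fix y assume y: "y \<in> ?T"
    have "y \<notin> interior ?S"
    proof
      assume "y \<in> interior ?S"
      then obtain d where d: "d > 0" "ball y d \<subseteq> ?S" by (auto simp: mem_interior)
      have "y \<noteq> 0" using y by (auto simp: proj_perp_def)
      \<comment> \<open>Stretching \<open>y\<close> by \<open>1 + h\<close> stays in the ball of
        radius \<open>d\<close> but pushes the projection outside the unit ball.\<close>
      define h where "h = d / (2 * norm y)"
      have h: "h > 0" using d \<open>y \<noteq> 0\<close> by (simp add: h_def)
      have "dist y ((1 + h) *\<^sub>R y) = d / 2"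
        using h \<open>y \<noteq> 0\<close> by (simp add: dist_norm scaleR_add_left) (simp add: h_def)
      then have "(1 + h) *\<^sub>R y \<in> ball y d" using d by simp
      then have "norm (proj_perp e ((1 + h) *\<^sub>R y)) \<le> 1" using d by auto
      then show False using y h by (simp add: linear_scale[OF linear_proj_perp])
    qed
    moreover have "y \<in> closure ?S" using y closure_subset[of ?S] by auto
    ultimately show "y \<in> frontier ?S" by (simp add: frontier_def)
  qed
  ultimately have "negligible ?T"
    using negligible_convex_frontier negligible_subset by blast
  then have "?T \<in> null_sets lebesgue" by (simp add: negligible_iff_null_sets)
  moreover have "?T \<in> sets lborel" by measurable
  ultimately have "?T \<in> null_sets lborel" using null_sets_completion_iff by blast
  then show ?thesis by (rule AE_I') auto
qed

text \<open>Anisotropic rescaling: the directions orthogonal to \<open>e\<close> by \<open>s\<close>, the direction \<open>e\<close> by \<open>s\<^sup>2\<close>.\<close>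

lemma emeasure_Int_cball_rescale:
  fixes e :: "'a::euclidean_space"
  assumes [measurable]: "E \<in> sets borel" and e: "norm e = 1" and s: "s > 0"
  shows "emeasure lborel (E \<inter> cball 0 s) = ennreal (s ^ (DIM('a) + 1)) *
    (\<integral>\<^sup>+y. indicator {y. \<bar>y \<bullet> e\<bar> \<le> 1/2} y * (\<integral>\<^sup>+t. indicator E (s *\<^sub>R (proj_perp e y + (s * t) *\<^sub>R e)) *
       indicator (cball 0 1) (proj_perp e y + (s * t) *\<^sub>R e) \<partial>lborel) \<partial>lborel)"
proof -
  have [measurable]: "cball (0::'a) r \<in> sets borel" for r by simp
  have mem: "s *\<^sub>R z \<in> cball 0 s \<longleftrightarrow> z \<in> cball 0 1" for z :: 'a
    using s by simp
  let ?G = "\<lambda>z. indicator E (s *\<^sub>R z) * indicator (cball 0 1) z :: ennreal"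
  have [measurable]: "{y. \<bar>y \<bullet> e\<bar> \<le> 1/2} \<in> sets borel" by measurable
  have "emeasure lborel (E \<inter> cball 0 s) = (\<integral>\<^sup>+z. indicator (E \<inter> cball 0 s) z \<partial>lborel)" by simp
  \<comment> \<open>The isotropic scaling contributes \<open>s ^ DIM('a)\<close>; substituting
    \<open>s * t\<close> for the coordinate along \<open>e\<close> contributes the last factor
    \<open>s\<close>.\<close>
  also have "\<dots> = ennreal (s ^ DIM('a)) * (\<integral>\<^sup>+z. indicator (E \<inter> cball 0 s) (s *\<^sub>R z) \<partial>lborel)"
    by (rule nn_integral_lborel_scale) (use s in simp_all)
  also have "(\<integral>\<^sup>+z. indicator (E \<inter> cball 0 s) (s *\<^sub>R z) \<partial>lborel) = (\<integral>\<^sup>+z. ?G z \<partial>lborel)"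
    by (intro nn_integral_cong) (simp only: indicator_inter_arith, simp only: indicator_def mem)
  also have "\<dots> = (\<integral>\<^sup>+y. indicator {y. \<bar>y \<bullet> e\<bar> \<le> 1/2} y *
        (\<integral>\<^sup>+t. ?G (proj_perp e y + t *\<^sub>R e) \<partial>lborel) \<partial>lborel)"
    unfolding proj_perp_def by (rule nn_integral_slab[OF _ e]) measurable
  also have "\<dots> = (\<integral>\<^sup>+y. indicator {y. \<bar>y \<bullet> e\<bar> \<le> 1/2} y *
        (ennreal s * (\<integral>\<^sup>+t. ?G (proj_perp e y + (s * t) *\<^sub>R e) \<partial>lborel)) \<partial>lborel)"
  proof (intro nn_integral_cong arg_cong2[where f = "(*)"] refl)
    show "(\<integral>\<^sup>+t. ?G (proj_perp e y + t *\<^sub>R e) \<partial>lborel) =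
      ennreal s * (\<integral>\<^sup>+t. ?G (proj_perp e y + (s * t) *\<^sub>R e) \<partial>lborel)" for y
      using s nn_integral_real_affine[of "\<lambda>t. ?G (proj_perp e y + t *\<^sub>R e)" s 0] by simp
  qed
  also have "\<dots> = ennreal s * (\<integral>\<^sup>+y. indicator {y. \<bar>y \<bullet> e\<bar> \<le> 1/2} y *
        (\<integral>\<^sup>+t. ?G (proj_perp e y + (s * t) *\<^sub>R e) \<partial>lborel) \<partial>lborel)"
    by (subst nn_integral_cmult[symmetric]) (simp_all add: ac_simps)
  finally show ?thesis using s by (simp add: ennreal_mult ac_simps)
qed

text \<open>In the rescaled coordinates \<open>F\<close> divided by the square of \<open>s\<close>
  tends to \<open>r * (t + q y)\<close>, so the set becomes the segment \<open>- q y < t < 0\<close>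
  over each point of the open disc, of length \<open>max 0 (q y)\<close>. Dominated convergence is
  applied first in \<open>t\<close>, then in \<open>y\<close>. The set \<open>E\<close> is
  prescribed only up to the boundary cases \<open>F z = 0\<close> and
  \<open>e \<bullet> z = 0\<close>, so that both sets in the curvature are covered.\<close>

lemma tendsto_volume_between_graph_and_plane:
  fixes e :: "'a::euclidean_space" and H :: "'a \<Rightarrow> 'a" and F \<rho> :: "'a \<Rightarrow> real"
  assumes [measurable]: "E \<in> sets borel" and e: "norm e = 1" and r: "r > 0"
    and H: "bounded_linear H"
    and F: "\<And>z. F z = r * (e \<bullet> z) + z \<bullet> H z / 2 + \<rho> z * (norm z)\<^sup>2"
    and \<rho>: "(\<rho> \<longlongrightarrow> 0) (nhds 0)"
    and sub: "\<And>z. F z > 0 \<Longrightarrow> e \<bullet> z < 0 \<Longrightarrow> z \<in> E"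
    and sup: "\<And>z. z \<in> E \<Longrightarrow> F z \<ge> 0" "\<And>z. z \<in> E \<Longrightarrow> e \<bullet> z \<le> 0"
  shows "((\<lambda>s. measure lborel (E \<inter> cball 0 s) / s ^ (DIM('a) + 1)) \<longlongrightarrow>
    (LINT y:cyl e|lborel. max 0 (proj_perp e y \<bullet> H (proj_perp e y) / (2 * r)))) (at_right 0)"
proof -
  have [measurable]: "cball (0::'a) r \<in> sets borel" for r by simp
  have [measurable]: "cyl e \<in> sets borel" by (rule borel_closed[OF closed_cyl])
  have [measurable]: "{y. \<bar>y \<bullet> e\<bar> \<le> 1/2} \<in> sets borel" by measurable
  have Hc: "continuous_on S H" for S by (rule linear_continuous_on[OF H])
  have [measurable]: "H \<in> borel_measurable borel" by (rule borel_measurable_continuous_onI[OF Hc])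
  define q where "q y = proj_perp e y \<bullet> H (proj_perp e y) / (2 * r)" for y
  have q_cont: "continuous_on UNIV q"
    unfolding q_def using r
    by (intro continuous_intros continuous_on_compose2[OF Hc[of UNIV]]) auto
  have [measurable]: "q \<in> borel_measurable borel" by (rule borel_measurable_continuous_onI[OF q_cont])
  have ee: "e \<bullet> e = 1" using e by (simp add: norm_eq_1)
  have perp: "e \<bullet> proj_perp e y = 0" for y
    using proj_perp_inner[OF e] by (simp add: inner_commute)
  \<comment> \<open>The actual point is \<open>s *\<^sub>R w s y t\<close>; its coordinate along
    \<open>e\<close> is \<open>t\<close> times the square of \<open>s\<close>.\<close>
  define w where "w s y t = proj_perp e y + (s * t) *\<^sub>R e" for s y t
  define u where "u s y t = (indicator E (s *\<^sub>R w s y t) * indicator (cball 0 1) (w s y t) :: ennreal)" for s y t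
  have [measurable]: "u s y \<in> borel_measurable borel" for s y unfolding u_def w_def by measurable
  have [measurable]: "case_prod (u s) \<in> borel_measurable (borel \<Otimes>\<^sub>M borel)" for s
    unfolding u_def w_def split_beta by measurable
  define K where "K s = (\<integral>\<^sup>+y. indicator {y. \<bar>y \<bullet> e\<bar> \<le> 1/2} y * (\<integral>\<^sup>+t. u s y t \<partial>lborel) \<partial>lborel)" for s
  define L where "L = (LINT y:cyl e|lborel. max 0 (q y))"
  have ew: "e \<bullet> (s *\<^sub>R w s y t) = s\<^sup>2 * t" for s y t
    by (simp add: w_def inner_add_right perp ee power2_eq_square)
  have norm_w: "norm (proj_perp e y) \<le> norm (w s y t)" for s y t
  proof -
    have "(norm (w s y t))\<^sup>2 = (norm (proj_perp e y))\<^sup>2 + (s * t)\<^sup>2"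
      unfolding w_def power2_norm_eq_inner
      by (simp add: inner_add_left inner_add_right perp proj_perp_inner[OF e] ee power2_eq_square)
    then have "(norm (proj_perp e y))\<^sup>2 \<le> (norm (w s y t))\<^sup>2" by simp
    then show ?thesis by (rule power2_le_imp_le) simp
  qed
  have Fw: "F (s *\<^sub>R w s y t) = s\<^sup>2 * (r * t + w s y t \<bullet> H (w s y t) / 2 + \<rho> (s *\<^sub>R w s y t) * (norm (w s y t))\<^sup>2)" for s y t
    unfolding F ew
    by (simp add: linear_scale[OF bounded_linear.linear[OF H]] power_mult_distrib)
       (simp add: power2_eq_square algebra_simps)
  have "eventually (\<lambda>z. dist (\<rho> z) 0 < 1) (nhds 0)"
    using \<rho> by (rule tendstoD) simp
  then obtain d where d: "d > 0" "\<And>z. norm z < d \<Longrightarrow> \<bar>\<rho> z\<bar> < 1"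
    by (auto simp: eventually_nhds_metric)
  \<comment> \<open>If \<open>F \<ge> 0\<close> at a point with
    \<open>norm (w s y t) \<le> 1\<close>, the quadratic term is at most \<open>onorm H / 2\<close>
    and the error at most 1, whence \<open>t \<ge> - M\<close> uniformly in \<open>s\<close> and
    \<open>y\<close>.\<close>
  define M where "M = (onorm H / 2 + 1) / r"
  have M: "M \<ge> 0" using r onorm_pos_le[OF H] by (simp add: M_def)
  have u_bound: "u s y t \<le> indicator {- M..0} t" if s: "0 < s" "s < d" for s y t
  proof (cases "s *\<^sub>R w s y t \<in> E \<and> norm (w s y t) \<le> 1")
    case True
    let ?w = "w s y t"
    have "norm (s *\<^sub>R ?w) \<le> s" using True s by (simp add: mult_left_le)
    then have "\<bar>\<rho> (s *\<^sub>R ?w)\<bar> < 1" using s by (intro d) linarith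
    moreover have n: "(norm ?w)\<^sup>2 \<le> 1" using True by (simp add: power_le_one)
    ultimately have 1: "\<rho> (s *\<^sub>R ?w) * (norm ?w)\<^sup>2 \<le> 1"
      by (smt (verit) mult_le_one mult_nonneg_nonneg mult_nonpos_nonneg zero_le_power2)
    have "?w \<bullet> H ?w \<le> norm ?w * (onorm H * norm ?w)"
      by (intro order_trans[OF norm_cauchy_schwarz] mult_left_mono onorm[OF H]) simp
    also have "\<dots> = onorm H * (norm ?w)\<^sup>2" by (simp add: power2_eq_square)
    also have "\<dots> \<le> onorm H" using n onorm_pos_le[OF H] by (simp add: mult_left_le)
    finally have 2: "?w \<bullet> H ?w \<le> onorm H" .
    have "0 \<le> r * t + ?w \<bullet> H ?w / 2 + \<rho> (s *\<^sub>R ?w) * (norm ?w)\<^sup>2"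
      using sup(1)[of "s *\<^sub>R ?w"] True s by (simp add: Fw zero_le_mult_iff)
    then have "0 \<le> r * t + (onorm H / 2 + 1)" using 1 2 by linarith
    then have "- M \<le> t" using r by (simp add: M_def field_simps)
    moreover have "t \<le> 0" using sup(2)[of "s *\<^sub>R ?w", unfolded ew] True s by (simp add: mult_le_0_iff)
    ultimately show ?thesis by (auto simp: indicator_def u_def)
  qed (auto simp: u_def indicator_def)
  have inner_bound: "(\<integral>\<^sup>+t. u s y t \<partial>lborel) \<le> ennreal M" if s: "0 < s" "s < d" for s y
  proof -
    have "(\<integral>\<^sup>+t. u s y t \<partial>lborel) \<le> (\<integral>\<^sup>+t. indicator {- M..0} t \<partial>lborel)"
      by (intro nn_integral_mono u_bound s)
    then show ?thesis using M by simp
  qed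
  have inner_0: "(\<integral>\<^sup>+t. u s y t \<partial>lborel) = 0" if "norm (proj_perp e y) > 1" for s y
  proof -
    have "u s y t = 0" for t using norm_w[of y s t] that by (simp add: u_def indicator_def)
    then show ?thesis by simp
  qed
  have slab_cyl: "indicator {y. \<bar>y \<bullet> e\<bar> \<le> 1/2} y = (indicator (cyl e) y :: ennreal)"
    if "norm (proj_perp e y) \<le> 1" for y
    using that by (simp add: indicator_def cyl_def)
  have not_cyl: "y \<notin> cyl e" if "norm (proj_perp e y) > 1" for y
    using that by (simp add: cyl_def)
  have inner_lim: "(\<lambda>n. \<integral>\<^sup>+t. u (X n) y t \<partial>lborel) \<longlonglongrightarrow> ennreal (max 0 (q y))"
    if X: "\<And>n. 0 < X n" "\<And>n. X n < d" "X \<longlonglongrightarrow> 0" and y: "norm (proj_perp e y) < 1" for X y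
  proof -
    have "(\<lambda>n. \<integral>\<^sup>+t. u (X n) y t \<partial>lborel) \<longlonglongrightarrow> (\<integral>\<^sup>+t. indicator {- q y<..<0} t \<partial>lborel)"
    proof (rule nn_integral_dominated_convergence)
      show "AE t in lborel. u (X n) y t \<le> indicator {- M..0} t" for n
        using u_bound X by simp
      show "(\<integral>\<^sup>+t. indicator {- M..0} t \<partial>lborel) < \<infinity>" using M by simp
      \<comment> \<open>At these two heights the limit inequality degenerates and membership in
        \<open>E\<close> is undetermined.\<close>
      have "AE t in lborel. t \<noteq> 0 \<and> t \<noteq> - q y"
        using AE_lborel_singleton[of 0] AE_lborel_singleton[of "- q y"] by eventually_elim auto
      then show "AE t in lborel. (\<lambda>n. u (X n) y t) \<longlonglongrightarrow> indicator {- q y<..<0} t"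
      proof eventually_elim
        case (elim t)
        let ?w = "\<lambda>n. w (X n) y t"
        have "?w \<longlonglongrightarrow> proj_perp e y + (0 * t) *\<^sub>R e"
          unfolding w_def by (intro tendsto_intros X)
        then have w: "?w \<longlonglongrightarrow> proj_perp e y" by simp
        then have "(\<lambda>n. norm (?w n)) \<longlonglongrightarrow> norm (proj_perp e y)" by (rule tendsto_norm)
        then have ev1: "eventually (\<lambda>n. norm (?w n) < 1) sequentially" using y by (rule order_tendstoD)
        have "(\<lambda>n. X n *\<^sub>R ?w n) \<longlonglongrightarrow> 0 *\<^sub>R proj_perp e y" by (intro tendsto_intros X w)
        then have "filterlim (\<lambda>n. X n *\<^sub>R ?w n) (nhds 0) sequentially" by simp
        then have "(\<lambda>n. \<rho> (X n *\<^sub>R ?w n)) \<longlonglongrightarrow> 0" by (rule filterlim_compose[OF \<rho>])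
        moreover have "(\<lambda>n. H (?w n)) \<longlonglongrightarrow> H (proj_perp e y)" by (rule bounded_linear.tendsto[OF H w])
        ultimately have "(\<lambda>n. r * t + ?w n \<bullet> H (?w n) / 2 + \<rho> (X n *\<^sub>R ?w n) * (norm (?w n))\<^sup>2)
            \<longlonglongrightarrow> r * t + proj_perp e y \<bullet> H (proj_perp e y) / 2 + 0 * (norm (proj_perp e y))\<^sup>2"
          by (intro tendsto_intros w) auto
        also have "r * t + proj_perp e y \<bullet> H (proj_perp e y) / 2 + 0 * (norm (proj_perp e y))\<^sup>2 = r * (t + q y)"
          using r by (simp add: q_def field_simps)
        finally have lim: "(\<lambda>n. r * t + ?w n \<bullet> H (?w n) / 2 + \<rho> (X n *\<^sub>R ?w n) * (norm (?w n))\<^sup>2)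
            \<longlonglongrightarrow> r * (t + q y)" .
        consider "t > 0" | "t < 0" "t + q y < 0" | "t < 0" "t + q y > 0" using elim by linarith
        then have "eventually (\<lambda>n. u (X n) y t = indicator {- q y<..<0} t) sequentially"
        proof cases
          case 1
          have "X n *\<^sub>R ?w n \<notin> E" for n
            using sup(2)[of "X n *\<^sub>R ?w n", unfolded ew] X(1)[of n] 1 by (auto simp: mult_le_0_iff)
          then show ?thesis using 1 by (simp add: u_def)
        next
          case 2
          then have "r * (t + q y) < 0" using r by (simp add: mult_pos_neg)
          with lim have "eventually (\<lambda>n. r * t + ?w n \<bullet> H (?w n) / 2 + \<rho> (X n *\<^sub>R ?w n) * (norm (?w n))\<^sup>2 < 0) sequentially"
            by (rule order_tendstoD)
          then show ?thesis
          proof eventually_elim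
            case (elim n)
            then have "F (X n *\<^sub>R ?w n) < 0" using X(1)[of n] by (simp add: Fw mult_pos_neg)
            then have "X n *\<^sub>R ?w n \<notin> E" using sup(1) by force
            then show ?case using 2 by (simp add: u_def)
          qed
        next
          case 3
          then have "r * (t + q y) > 0" using r by simp
          with lim have "eventually (\<lambda>n. r * t + ?w n \<bullet> H (?w n) / 2 + \<rho> (X n *\<^sub>R ?w n) * (norm (?w n))\<^sup>2 > 0) sequentially"
            by (rule order_tendstoD)
          with ev1 show ?thesis
          proof eventually_elim
            case (elim n)
            then have "F (X n *\<^sub>R ?w n) > 0" using X(1)[of n] by (simp add: Fw)
            moreover have "e \<bullet> (X n *\<^sub>R ?w n) < 0" unfolding ew using 3 X(1)[of n] by (simp add: mult_pos_neg)
            ultimately have "X n *\<^sub>R ?w n \<in> E" by (rule sub)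
            then show ?case using 3 elim by (simp add: u_def)
          qed
        qed
        then show ?case by (rule tendsto_eventually)
      qed
    qed simp_all
    moreover have "(\<integral>\<^sup>+t. indicator {- q y<..<0} t \<partial>lborel) = ennreal (max 0 (q y))"
      by (cases "q y \<ge> 0") (auto simp: max_def)
    ultimately show ?thesis by simp
  qed
  have "set_integrable lborel (cyl e) (\<lambda>y. max 0 (q y))"
    by (intro set_integrable_cyl[OF e] continuous_intros q_cont)
  then have L: "(\<integral>\<^sup>+y. indicator (cyl e) y * ennreal (max 0 (q y)) \<partial>lborel) = ennreal L"
    unfolding L_def set_integrable_def set_lebesgue_integral_def
    by (subst nn_integral_eq_integral[symmetric]) (auto simp: ennreal_mult ennreal_indicator)
  have L0: "L \<ge> 0"
    unfolding L_def set_lebesgue_integral_def by (rule Bochner_Integration.integral_nonneg) simp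
  have cyl_fin: "emeasure lborel (cyl e) < \<infinity>"
    by (rule emeasure_compact_finite[OF compact_cyl[OF e]])
  \<comment> \<open>Restricting to \<open>{0<..<d}\<close> makes the uniform bounds available for
    every term of a test sequence.\<close>
  have "(K \<longlongrightarrow> ennreal L) (at 0 within {0<..<d})"
    unfolding tendsto_at_iff_sequentially
  proof (intro allI impI)
    fix X assume "\<forall>i. X i \<in> {0<..<d} - {0::real}" and X0: "X \<longlonglongrightarrow> 0"
    then have X: "\<And>n. 0 < X n" "\<And>n. X n < d" by auto
    have "(\<lambda>n. K (X n)) \<longlonglongrightarrow> (\<integral>\<^sup>+y. indicator (cyl e) y * ennreal (max 0 (q y)) \<partial>lborel)"
      unfolding K_def
    proof (rule nn_integral_dominated_convergence[where w = "\<lambda>y. indicator (cyl e) y * ennreal M"])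
      show "AE y in lborel. indicator {y. \<bar>y \<bullet> e\<bar> \<le> 1/2} y * (\<integral>\<^sup>+t. u (X n) y t \<partial>lborel)
          \<le> indicator (cyl e) y * ennreal M" for n
      proof (rule AE_I2)
        fix y
        show "indicator {y. \<bar>y \<bullet> e\<bar> \<le> 1/2} y * (\<integral>\<^sup>+t. u (X n) y t \<partial>lborel) \<le> indicator (cyl e) y * ennreal M"
        proof (cases "norm (proj_perp e y) \<le> 1")
          case True
          show ?thesis
            unfolding slab_cyl[OF True] by (rule mult_left_mono[OF inner_bound[OF X]]) simp
        qed (simp add: inner_0)
      qed
      show "(\<integral>\<^sup>+y. indicator (cyl e) y * ennreal M \<partial>lborel) < \<infinity>"
        using cyl_fin by (simp add: nn_integral_multc ennreal_mult_less_top)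
      \<comment> \<open>Over the rim of the disc the cutoff by the unit ball need not converge, so
        that null set is left out.\<close>
      show "AE y in lborel. (\<lambda>n. indicator {y. \<bar>y \<bullet> e\<bar> \<le> 1/2} y * (\<integral>\<^sup>+t. u (X n) y t \<partial>lborel))
          \<longlonglongrightarrow> indicator (cyl e) y * ennreal (max 0 (q y))"
        using AE_norm_proj_perp_neq[of e]
      proof eventually_elim
        case (elim y)
        then consider "norm (proj_perp e y) < 1" | "norm (proj_perp e y) > 1" by linarith
        then show ?case
        proof cases
          case 1
          then have y: "norm (proj_perp e y) \<le> 1" by simp
          show ?thesis
            unfolding slab_cyl[OF y] using inner_lim[OF X X0 1] by (cases "y \<in> cyl e") simp_all
        qed (simp add: inner_0 not_cyl)
      qed
    qed measurable
    then show "(K \<circ> X) \<longlonglongrightarrow> ennreal L" by (simp add: L o_def)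
  qed
  moreover have "at 0 within {0<..<d} = at_right 0"
    by (rule at_within_nhd[of _ "{..<d}"]) (use d in auto)
  ultimately have "(K \<longlongrightarrow> ennreal L) (at_right 0)" by simp
  then have "((\<lambda>s. enn2real (K s)) \<longlongrightarrow> L) (at_right 0)"
    using tendsto_enn2real[of K L "at_right 0"] L0 by simp
  moreover have "eventually (\<lambda>s. enn2real (K s) = measure lborel (E \<inter> cball 0 s) / s ^ (DIM('a) + 1)) (at_right 0)"
    using eventually_at_right_less[of 0]
  proof eventually_elim
    case (elim s)
    have "emeasure lborel (E \<inter> cball 0 s) = ennreal (s ^ (DIM('a) + 1)) * K s"
      using emeasure_Int_cball_rescale[OF _ e elim, of E] by (simp add: K_def u_def w_def)
    then show ?case using elim by (simp add: measure_def enn2real_mult)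
  qed
  ultimately have "((\<lambda>s. measure lborel (E \<inter> cball 0 s) / s ^ (DIM('a) + 1)) \<longlongrightarrow> L) (at_right 0)"
    by (rule Lim_transform_eventually)
  then show ?thesis by (simp add: L_def q_def)
qed

section \<open>Curvature\<close>

text \<open>The layer-cake formula with exponent \<open>CARD('n) + \<alpha>\<close> turns the mass
  into the weighted integral of the normalised volume \<phi>, whose limit at 0 is known; the
  concentration of the weight then gives the limit of the masses.\<close>

lemma tendsto_nu_alpha:
  fixes e :: "real ^ 'n" and H :: "real ^ 'n \<Rightarrow> real ^ 'n" and F \<rho> :: "real ^ 'n \<Rightarrow> real"
  assumes E [measurable]: "E \<in> sets borel" and e: "norm e = 1" and r: "r > 0"
    and H: "bounded_linear H"
    and F: "\<And>z. F z = r * (e \<bullet> z) + z \<bullet> H z / 2 + \<rho> z * (norm z)\<^sup>2"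
    and \<rho>: "(\<rho> \<longlongrightarrow> 0) (nhds 0)"
    and sub: "\<And>z. F z > 0 \<Longrightarrow> e \<bullet> z < 0 \<Longrightarrow> z \<in> E"
    and sup: "\<And>z. z \<in> E \<Longrightarrow> F z \<ge> 0" "\<And>z. z \<in> E \<Longrightarrow> e \<bullet> z \<le> 0"
  shows "((\<lambda>\<alpha>. emeasure (nu_alpha \<alpha>) E) \<longlongrightarrow> ennreal ((real CARD('n) + 1) *
    (LINT y:cyl e|lborel. max 0 (proj_perp e y \<bullet> H (proj_perp e y) / (2 * r))))) (at_left 1)"
proof -
  let ?n = "CARD('n)"
  define \<phi> where "\<phi> s = measure lborel (E \<inter> cball 0 s) / s ^ (?n + 1)" for s
  have lim: "(\<phi> \<longlongrightarrow> (LINT y:cyl e|lborel. max 0 (proj_perp e y \<bullet> H (proj_perp e y) / (2 * r)))) (at_right 0)"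
    using tendsto_volume_between_graph_and_plane[OF E e r H F \<rho> sub sup] by (simp add: \<phi>_def[abs_def])
  have fin: "emeasure lborel (E \<inter> cball 0 s) < \<infinity>" for s
    by (rule le_less_trans[OF emeasure_mono emeasure_lborel_cball_finite[of 0 s]]) auto
  have fm: "E \<inter> cball 0 s \<in> fmeasurable lborel" "cball 0 s \<in> fmeasurable lborel" for s
    using fin[of s] emeasure_lborel_cball_finite[of 0 s] by (auto intro!: fmeasurableI)
  \<comment> \<open>Measurability in the radius comes from monotonicity.\<close>
  have "mono (\<lambda>s. measure lborel (E \<inter> cball 0 s))"
    by (intro monoI measure_mono_fmeasurable fm) (auto simp: fmeasurableD fm)
  then have [measurable]: "(\<lambda>s. measure lborel (E \<inter> cball 0 s)) \<in> borel_measurable borel"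
    by (rule borel_measurable_mono)
  have [measurable]: "\<phi> \<in> borel_measurable borel" unfolding \<phi>_def by measurable
  have pos: "0 \<le> \<phi> s" if "s > 0" for s using that by (simp add: \<phi>_def)
  \<comment> \<open>Comparison with the whole ball loses one power of \<open>s\<close>, which is
    just the decay needed away from 0.\<close>
  have bound: "\<phi> s \<le> measure lborel (cball (0::real^'n) 1) / s" if s: "s > 0" for s
  proof -
    have "measure lborel (E \<inter> cball 0 s) \<le> measure lborel (cball (0::real^'n) s)"
      by (intro measure_mono_fmeasurable fm) (auto simp: fmeasurableD fm)
    also have "\<dots> = s ^ ?n * measure lborel (cball (0::real^'n) 1)"
      using s by (simp add: content_cball)
    finally show ?thesis using s by (simp add: \<phi>_def field_simps)
  qed
  have eq: "emeasure (nu_alpha \<alpha>) E = (\<integral>\<^sup>+s. ennreal ((1 - \<alpha>) * (real ?n + \<alpha>) * s powr - \<alpha> * \<phi> s) * indicator {0<..} s \<partial>lborel)"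
    if a: "0 < \<alpha>" "\<alpha> < 1" for \<alpha>
  proof -
    let ?b = "real ?n + \<alpha>"
    have "(\<lambda>s. emeasure lborel (E \<inter> cball 0 s)) = (\<lambda>s. ennreal (measure lborel (E \<inter> cball 0 s)))"
      using fin by (intro ext emeasure_eq_ennreal_measure) (auto simp: less_top)
    then have [measurable]: "(\<lambda>s. emeasure lborel (E \<inter> cball 0 s)) \<in> borel_measurable borel" by simp
    have "emeasure (nu_alpha \<alpha>) E = (\<integral>\<^sup>+z. ennreal (1 - \<alpha>) * (ennreal (1 / norm z powr ?b) * indicator E z) \<partial>lborel)"
      unfolding nu_alpha_def using a
      by (subst emeasure_density) (auto intro!: nn_integral_cong simp: ennreal_mult[symmetric] mult.assoc[symmetric])
    also have "\<dots> = ennreal (1 - \<alpha>) * (\<integral>\<^sup>+z. ennreal (1 / norm z powr ?b) * indicator E z \<partial>lborel)"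
      by (rule nn_integral_cmult) measurable
    also have "\<dots> = ennreal (1 - \<alpha>) * (\<integral>\<^sup>+s. ennreal (?b * s powr (- ?b - 1)) * indicator {0<..} s * emeasure lborel (E \<inter> cball 0 s) \<partial>lborel)"
      using a by (subst nn_integral_layer_cake) (auto intro!: add_nonneg_pos)
    also have "\<dots> = (\<integral>\<^sup>+s. ennreal (1 - \<alpha>) * (ennreal (?b * s powr (- ?b - 1)) * indicator {0<..} s * emeasure lborel (E \<inter> cball 0 s)) \<partial>lborel)"
      by (rule nn_integral_cmult[symmetric]) measurable
    also have "\<dots> = (\<integral>\<^sup>+s. ennreal ((1 - \<alpha>) * ?b * s powr - \<alpha> * \<phi> s) * indicator {0<..} s \<partial>lborel)"
    proof (rule nn_integral_cong)
      fix s :: real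
      show "ennreal (1 - \<alpha>) * (ennreal (?b * s powr (- ?b - 1)) * indicator {0<..} s * emeasure lborel (E \<inter> cball 0 s))
        = ennreal ((1 - \<alpha>) * ?b * s powr - \<alpha> * \<phi> s) * indicator {0<..} s"
      proof (cases "s > 0")
        case True
        let ?m = "measure lborel (E \<inter> cball 0 s)"
        have "s powr (- ?b - 1) = s powr (- \<alpha> - real (?n + 1))" by (simp add: algebra_simps)
        also have "\<dots> = s powr - \<alpha> / s ^ (?n + 1)"
          using True by (simp add: powr_diff powr_realpow del: of_nat_add of_nat_Suc)
        finally have p: "s powr (- ?b - 1) = s powr - \<alpha> / s ^ (?n + 1)" .
        have "emeasure lborel (E \<inter> cball 0 s) = ennreal ?m"
          using fin[of s] by (simp add: emeasure_eq_ennreal_measure)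
        then have "ennreal (1 - \<alpha>) * (ennreal (?b * s powr (- ?b - 1)) * emeasure lborel (E \<inter> cball 0 s))
           = ennreal ((1 - \<alpha>) * (?b * s powr (- ?b - 1) * ?m))"
          using a by (simp add: ennreal_mult[symmetric] del: ennreal_plus)
        also have "(1 - \<alpha>) * (?b * s powr (- ?b - 1) * ?m) = (1 - \<alpha>) * ?b * s powr - \<alpha> * \<phi> s"
          unfolding p \<phi>_def by simp
        finally show ?thesis using True by simp
      qed simp
    qed
    finally show ?thesis .
  qed
  have "((\<lambda>\<alpha>. \<integral>\<^sup>+s. ennreal ((1 - \<alpha>) * (real ?n + \<alpha>) * s powr - \<alpha> * \<phi> s) * indicator {0<..} s \<partial>lborel)
     \<longlongrightarrow> ennreal ((real ?n + 1) * (LINT y:cyl e|lborel. max 0 (proj_perp e y \<bullet> H (proj_perp e y) / (2 * r))))) (at_left 1)"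
    by (rule tendsto_abelian[OF _ _ pos bound lim]) simp_all
  moreover have "eventually (\<lambda>\<alpha>::real. 0 < \<alpha> \<and> \<alpha> < 1) (at_left 1)"
    using eventually_at_left_real[of 0 "1::real"] by (auto elim!: eventually_mono)
  then have "eventually (\<lambda>\<alpha>. (\<integral>\<^sup>+s. ennreal ((1 - \<alpha>) * (real ?n + \<alpha>) * s powr - \<alpha> * \<phi> s) * indicator {0<..} s \<partial>lborel)
     = emeasure (nu_alpha \<alpha>) E) (at_left 1)"
    by (rule eventually_mono) (simp add: eq)
  ultimately show ?thesis by (rule Lim_transform_eventually)
qed

text \<open>The mean value theorem on the segment from \<open>x\<close> to \<open>x + z\<close>
  reduces the remainder to the first-order error of \<open>g\<close> at \<open>x\<close>, which is
  small compared with \<open>norm z\<close>. At \<open>z = 0\<close> the quotient is 0 by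
  convention, so the limit may be taken along \<open>nhds 0\<close>.\<close>

lemma second_order_taylor:
  fixes u :: "'a::euclidean_space \<Rightarrow> real"
  assumes u: "\<And>y. GDERIV u y :> g y" and g: "(g has_derivative H) (at x)"
  shows "((\<lambda>z. (u (x + z) - u x - g x \<bullet> z - z \<bullet> H z / 2) / (norm z)\<^sup>2) \<longlongrightarrow> 0) (nhds 0)"
proof (rule tendstoI)
  fix \<epsilon> :: real assume eps: "\<epsilon> > 0"
  have lin: "linear H" using g by (rule has_derivative_linear)
  obtain d where d: "d > 0" "\<And>y. norm (y - x) < d \<Longrightarrow> norm (g y - g x - H (y - x)) \<le> \<epsilon> / 2 * norm (y - x)"
    using has_derivative_at_alt[THEN iffD1, OF g, THEN conjunct2, rule_format, of "\<epsilon> / 2"] eps by auto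
  have "\<bar>u (x + z) - u x - g x \<bullet> z - z \<bullet> H z / 2\<bar> \<le> \<epsilon> / 2 * (norm z)\<^sup>2" if z: "norm z < d" for z
  proof -
    let ?f = "\<lambda>t. u (x + t *\<^sub>R z) - t * (g x \<bullet> z) - t\<^sup>2 * (z \<bullet> H z) / 2"
    let ?f' = "\<lambda>t. z \<bullet> (g (x + t *\<^sub>R z) - g x - t *\<^sub>R H z)"
    have "(?f has_real_derivative ?f' t) (at t)" for t
    proof -
      have "((\<lambda>t. x + t *\<^sub>R z) has_derivative (\<lambda>h. h *\<^sub>R z)) (at t)"
        by (auto intro!: derivative_eq_intros)
      from has_derivative_compose[OF this u[unfolded gderiv_def]]
      have "((\<lambda>t. u (x + t *\<^sub>R z)) has_derivative (\<lambda>h. (h *\<^sub>R z) \<bullet> g (x + t *\<^sub>R z))) (at t)" .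
      then have "((\<lambda>t. u (x + t *\<^sub>R z)) has_real_derivative z \<bullet> g (x + t *\<^sub>R z)) (at t)"
        by (simp add: has_field_derivative_def mult_commute_abs)
      then show ?thesis
        by (auto intro!: derivative_eq_intros simp: inner_diff_right inner_commute)
    qed
    then obtain t where t: "0 < t" "t < 1" "?f 1 - ?f 0 = (1 - 0) * ?f' t"
      using MVT2[of 0 1 ?f ?f'] by auto
    have tz: "norm (t *\<^sub>R z) \<le> norm z" using t by (simp add: mult_left_le_one_le)
    have "norm (g (x + t *\<^sub>R z) - g x - t *\<^sub>R H z) \<le> \<epsilon> / 2 * norm (t *\<^sub>R z)"
      using d(2)[of "x + t *\<^sub>R z"] tz z by (simp add: linear_scale[OF lin])
    also have "\<dots> \<le> \<epsilon> / 2 * norm z" using tz eps by (intro mult_left_mono) auto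
    finally have *: "norm (g (x + t *\<^sub>R z) - g x - t *\<^sub>R H z) \<le> \<epsilon> / 2 * norm z" .
    have "u (x + z) - u x - g x \<bullet> z - z \<bullet> H z / 2 = ?f' t" using t(3) by simp
    also have "\<bar>\<dots>\<bar> \<le> norm z * norm (g (x + t *\<^sub>R z) - g x - t *\<^sub>R H z)"
      by (rule Cauchy_Schwarz_ineq2)
    also have "\<dots> \<le> norm z * (\<epsilon> / 2 * norm z)" by (intro mult_left_mono * norm_ge_zero)
    finally show ?thesis by (simp add: power2_eq_square ac_simps)
  qed
  note bound = this
  have "dist ((u (x + z) - u x - g x \<bullet> z - z \<bullet> H z / 2) / (norm z)\<^sup>2) 0 < \<epsilon>" if "norm z < d" for z
  proof (cases "z = 0")
    case False
    then have "0 < \<epsilon> * (norm z)\<^sup>2" using eps by simp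
    then show ?thesis using bound[OF that] False by (simp add: abs_divide divide_less_eq)
  qed (simp add: eps)
  then show "eventually (\<lambda>z. dist ((u (x + z) - u x - g x \<bullet> z - z \<bullet> H z / 2) / (norm z)\<^sup>2) 0 < \<epsilon>) (nhds 0)"
    using d(1) by (auto simp: eventually_nhds_metric)
qed

theorem proposition2:
  "\<exists>C::real. C > 0 \<and>
    (\<forall>(u :: real ^ 'n \<Rightarrow> real) (x :: real ^ 'n).
      is_C2 u \<longrightarrow> grad u x \<noteq> 0 \<longrightarrow>
      ((\<lambda>\<alpha>. frac_mean_curvature (nu_alpha \<alpha>) x u) \<longlongrightarrow>
        ereal (C * divergence (\<lambda>y. grad u y /\<^sub>R norm (grad u y)) x)) (at_left 1))"
proof -
  obtain c where c: "c > 0"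
    "\<And>e a :: real ^ 'n. norm e = 1 \<Longrightarrow> cyl_moment e a = c * (norm (proj_perp e a))\<^sup>2"
    using cyl_moment_isotropic by blast
  let ?n1 = "real CARD('n) + 1"
  \<comment> \<open>The factor \<open>?n1\<close> comes from the concentration limit,
    \<open>c\<close> from the moments of the disc and 1/2 from the quadratic Taylor term.\<close>
  let ?C = "?n1 * c / 2"
  show ?thesis
  proof (intro exI[of _ ?C] conjI allI impI)
    show "?C > 0" using c by simp
  next
    fix u :: "real ^ 'n \<Rightarrow> real" and x :: "real ^ 'n"
    assume "is_C2 u" and nz: "grad u x \<noteq> 0"
    then obtain g and HB :: "real ^ 'n \<Rightarrow> (real ^ 'n) \<Rightarrow>\<^sub>L (real ^ 'n)"
      where u: "\<And>y. GDERIV u y :> g y" and g: "\<And>y. (g has_derivative blinfun_apply (HB y)) (at y)"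
      by (auto simp: is_C2_def)
    \<comment> \<open>Since \<open>grad\<close> is a definite description, uniqueness of the
      gradient has to be shown.\<close>
    have "grad u y = g y" for y
      unfolding grad_def
    proof (rule the_equality)
      show "GDERIV u y :> g y" by (rule u)
      fix D assume "GDERIV u y :> D"
      then have "(\<lambda>h. h \<bullet> D) = (\<lambda>h. h \<bullet> g y)"
        using u[of y] unfolding gderiv_def by (rule has_derivative_unique)
      then show "D = g y" by (metis vector_eq_ldot)
    qed
    then have grad: "grad u = g" by auto
    define r where "r = norm (g x)"
    define e where "e = g x /\<^sub>R r"
    define H where "H = blinfun_apply (HB x)"
    have r: "r > 0" using nz by (simp add: r_def grad)
    have e: "norm e = 1" using r by (simp add: e_def r_def)
    have gx: "g x = r *\<^sub>R e" using r by (simp add: e_def)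
    have H: "bounded_linear H" unfolding H_def by (rule blinfun.bounded_linear_right)
    have Hm: "bounded_linear (\<lambda>z. - H z)" by (rule bounded_linear_minus[OF H])
    define F where "F z = u (x + z) - u x" for z
    define \<rho> where "\<rho> z = (F z - g x \<bullet> z - z \<bullet> H z / 2) / (norm z)\<^sup>2" for z
    have \<rho>: "(\<rho> \<longlongrightarrow> 0) (nhds 0)"
      unfolding \<rho>_def F_def H_def using second_order_taylor[OF u g] by simp
    then have \<rho>m: "((\<lambda>z. - \<rho> z) \<longlongrightarrow> 0) (nhds 0)"
      using tendsto_minus by fastforce
    have F: "F z = r * (e \<bullet> z) + z \<bullet> H z / 2 + \<rho> z * (norm z)\<^sup>2" for z
      by (cases "z = 0") (simp_all add: \<rho>_def F_def gx)
    then have Fm: "- F z = r * (- e \<bullet> z) + z \<bullet> - H z / 2 + - \<rho> z * (norm z)\<^sup>2" for z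
      by simp
    have "continuous_on UNIV u"
      using u unfolding gderiv_def
      by (meson continuous_at_imp_continuous_on has_derivative_continuous)
    then have [measurable]: "u \<in> borel_measurable borel" by (rule borel_measurable_continuous_onI)
    let ?A = "{z. u (x + z) \<ge> u x \<and> grad u x \<bullet> z \<le> 0}"
    let ?B = "{z. u (x + z) < u x \<and> grad u x \<bullet> z > 0}"
    let ?q = "\<lambda>y. proj_perp e y \<bullet> H (proj_perp e y) / (2 * r)"
    define a where "a = ?n1 * (LINT y:cyl e|lborel. max 0 (?q y))"
    define b where "b = ?n1 * (LINT y:cyl e|lborel. max 0 (- ?q y))"
    have sg: "grad u x \<bullet> z \<le> 0 \<longleftrightarrow> e \<bullet> z \<le> 0" "grad u x \<bullet> z > 0 \<longleftrightarrow> e \<bullet> z > 0" for z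
      using r by (auto simp: grad gx mult_le_0_iff zero_less_mult_iff)
    have A: "((\<lambda>\<alpha>. emeasure (nu_alpha \<alpha>) ?A) \<longlongrightarrow> ennreal a) (at_left 1)"
      unfolding a_def
      by (rule tendsto_nu_alpha[OF _ e r H F \<rho>]) (auto simp: sg F_def)
    \<comment> \<open>The second set has the shape of the first for \<open>- F\<close>,
      \<open>- e\<close>, \<open>- H\<close> and \<open>- \<rho>\<close>. The hyperplane and the
      cylinder stay the same, and \<open>?q\<close> changes sign.\<close>
    have "((\<lambda>\<alpha>. emeasure (nu_alpha \<alpha>) ?B) \<longlongrightarrow> ennreal (?n1 *
      (LINT y:cyl (- e)|lborel. max 0 (proj_perp (- e) y \<bullet> - H (proj_perp (- e) y) / (2 * r))))) (at_left 1)"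
      by (rule tendsto_nu_alpha[OF _ _ r Hm Fm \<rho>m]) (use e in \<open>auto simp: sg F_def\<close>)
    moreover have "proj_perp (- e) = proj_perp e" by (auto simp: proj_perp_def)
    moreover from this have "cyl (- e) = cyl e" by (auto simp: cyl_def)
    ultimately have B: "((\<lambda>\<alpha>. emeasure (nu_alpha \<alpha>) ?B) \<longlongrightarrow> ennreal b) (at_left 1)"
      by (simp add: b_def)
    have ab0: "a \<ge> 0" "b \<ge> 0"
      unfolding a_def b_def set_lebesgue_integral_def
      by (auto intro!: mult_nonneg_nonneg Bochner_Integration.integral_nonneg)
    \<comment> \<open>Both limits are finite, so subtraction in \<open>ereal\<close> is continuous
      there.\<close>
    have "((\<lambda>\<alpha>. frac_mean_curvature (nu_alpha \<alpha>) x u) \<longlongrightarrow> enn2ereal (ennreal a) - enn2ereal (ennreal b)) (at_left 1)"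
      unfolding frac_mean_curvature_def
      by (intro tendsto_diff_ereal tendsto_enn2erealI A B) (use ab0 in simp_all)
    also have "enn2ereal (ennreal a) - enn2ereal (ennreal b) = ereal (a - b)"
      using ab0 by simp
    also have "a - b = ?C * divergence (\<lambda>y. grad u y /\<^sub>R norm (grad u y)) x"
    proof -
      have qc: "continuous_on UNIV ?q"
        using r by (intro continuous_intros continuous_on_compose2[OF linear_continuous_on[OF H, of UNIV]]) auto
      have "set_integrable lborel (cyl e) (\<lambda>y. max 0 (?q y))" "set_integrable lborel (cyl e) (\<lambda>y. max 0 (- ?q y))"
        by (intro set_integrable_cyl[OF e] continuous_intros qc)+
      then have "a - b = ?n1 * (LINT y:cyl e|lborel. max 0 (?q y) - max 0 (- ?q y))"
        by (simp add: a_def b_def right_diff_distrib)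
      \<comment> \<open>Positive part minus negative part restores the quadratic form, whose
        integral is a trace.\<close>
      also have "(\<lambda>y. max 0 (?q y) - max 0 (- ?q y)) = ?q" by (auto simp: max_def)
      also have "(LINT y:cyl e|lborel. ?q y) = c * ((\<Sum>i\<in>Basis. i \<bullet> H i) - e \<bullet> H e) / (2 * r)"
        using integral_cyl_quadratic[OF e c(2)[OF e] bounded_linear.linear[OF H]] by simp
      also have "?n1 * \<dots> = ?C * (((\<Sum>i\<in>Basis. i \<bullet> H i) - e \<bullet> H e) / r)" by simp
      also have "((\<Sum>i\<in>Basis. i \<bullet> H i) - e \<bullet> H e) / r = divergence (\<lambda>y. g y /\<^sub>R norm (g y)) x"
        using divergence_normalised[OF g[of x]] r by (simp add: r_def e_def H_def)
      finally show ?thesis by (simp add: grad)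
    qed
    finally show "((\<lambda>\<alpha>. frac_mean_curvature (nu_alpha \<alpha>) x u) \<longlongrightarrow>
        ereal (?C * divergence (\<lambda>y. grad u y /\<^sub>R norm (grad u y)) x)) (at_left 1)" .
  qed
qed

end
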